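(* As $n\to\infty$, $$\chi(G(n,4,2)) \le (1+o(1))\,\frac{n^2}{6}.$$
   Context: $G(n,4,2)$ is the graph whose vertices are all $4$-element subsets of $[n]=\{1,\dots,n\}$, two vertices being adjacent if they intersect in exactly $2$ elements. $\chi$ denotes the chromatic number, and $o(1)$ is a quantity tending to $0$ as $n\to\infty$. *)

theory Defs
  imports Complex_Main "Graph_Theory.Pair_Digraph"
begin

text \<open>Undirected graphs are represented as symmetric digraphs, as in the locale
  \<^locale>\<open>graph\<close> of the AFP entry Graph_Theory.\<close>

definition proper_colouring :: "('a, 'b) pre_digraph \<Rightarrow> nat \<Rightarrow> ('a \<Rightarrow> nat) \<Rightarrow> bool" where
  "proper_colouring G k c \<longleftrightarrow>
     (\<forall>v \<in> verts G. c v < k) \<and> (\<forall>u v. u \<rightarrow>\<^bsub>G\<^esub> v \<longrightarrow> c u \<noteq> c v)"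

text \<open>Meaningful for graphs with a finite proper colouring, in particular for all finite
  loop-free graphs (lemma \<open>ex_proper_colouring\<close> below); \<open>LEAST\<close> is unspecified otherwise.\<close>

definition chromatic_number :: "('a, 'b) pre_digraph \<Rightarrow> nat" where
  "chromatic_number G = (LEAST k. \<exists>c. proper_colouring G k c)"

text \<open>The condition \<open>A \<noteq> B\<close> only matters in the degenerate case \<open>t = k\<close>; it
  makes the graph loop-free for all parameters.\<close>

definition intersection_graph ::
    "nat \<Rightarrow> nat \<Rightarrow> nat \<Rightarrow> (nat set, nat set \<times> nat set) pre_digraph" where
  "intersection_graph n k t = with_proj
     \<lparr> pverts = {A. A \<subseteq> {1..n} \<and> card A = k},
       parcs = {(A, B). A \<subseteq> {1..n} \<and> card A = k \<and> B \<subseteq> {1..n} \<and> card B = k \<and>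
                        A \<noteq> B \<and> card (A \<inter> B) = t} \<rparr>"

lemma ex_proper_colouring:
  assumes "graph G"
  shows "\<exists>k c. proper_colouring G k c"
proof -
  interpret graph G by fact
  obtain c where c: "bij_betw c (verts G) {0..<card (verts G)}"
    using ex_bij_betw_finite_nat[OF finite_verts] by blast
  have "c v < card (verts G)" if "v \<in> verts G" for v
    using bij_betwE[OF c] that by auto
  moreover have "c u \<noteq> c v" if "u \<rightarrow>\<^bsub>G\<^esub> v" for u v
  proof
    assume "c u = c v"
    then have "u = v"
      using c that by (meson adj_in_verts bij_betw_imp_inj_on inj_onD)
    with that adj_not_same show False by blast
  qed
  ultimately show ?thesis
    unfolding proper_colouring_def by blast
qed

lemma graph_intersection_graph: "graph (intersection_graph n k t)"
proof -
  define V where "V = {A. A \<subseteq> {1..n} \<and> card A = k}"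
  define E where "E = {(A, B). A \<subseteq> {1..n} \<and> card A = k \<and> B \<subseteq> {1..n} \<and> card B = k \<and>
                        A \<noteq> B \<and> card (A \<inter> B) = t}"
  have G: "intersection_graph n k t = with_proj \<lparr> pverts = V, parcs = E \<rparr>"
    unfolding intersection_graph_def V_def E_def ..
  have finV: "finite V"
    unfolding V_def by (rule finite_subset[of _ "Pow {1..n}"]) auto
  have sub: "E \<subseteq> V \<times> V"
    unfolding V_def E_def by blast
  have finE: "finite E"
    by (rule finite_subset[OF sub]) (simp add: finV)
  have loopfree: "fst e \<noteq> snd e" if "e \<in> E" for e
    using that unfolding E_def by force
  have sym: "sym E"
    unfolding E_def by (rule symI) (auto simp: Int_commute)
  show ?thesis
    unfolding G
    using finV sub finE loopfree sym
    by unfold_locales (auto simp: arc_to_ends_def symmetric_def)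
qed

end

theory Submission
  imports Defs "HOL-Combinatorics.Permutations" "HOL-Number_Theory.Cong"
    "HOL-Computational_Algebra.Polynomial" "HOL-Real_Asymp.Real_Asymp"
begin

text \<open>Two 4-sets are adjacent when they meet in exactly two points. Hence all 4-subsets of a 5-set
may share a colour, and so may all 4-subsets of several 5-sets that pairwise meet in at most one
point. A Steiner system \<open>S(2,5,m)\<close> has \<open>m(m-1)/20\<close> such 5-sets and thus yields an independent set of
\<open>m(m-1)/4\<close> vertices in \<open>G(m,4,2)\<close>. Averaging over its images under all permutations of the
\<open>m\<close> points gives a fractional colouring of \<open>G(m,4,2)\<close> of weight \<open>(m-2)(m-3)/6\<close>. The proof
turns this into a proper colouring of \<open>G(n,4,2)\<close>, for fixed \<open>m\<close> and \<open>n\<close> tending to infinity,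
by a blow-up.

Split the points into the \<open>m\<close> residue classes modulo \<open>m\<close>, called parts, and write a point \<open>v\<close>
as the pair of its part \<open>v mod m\<close> and its height \<open>v div m < q\<close>, where \<open>q\<close> is about \<open>n/m\<close> and
coprime to \<open>m!\<close>. A 4-set \<open>A\<close> that is transversal (at most one point in each part) lies on the
graph, over the ring of integers modulo \<open>q\<close>, of a polynomial of degree at most 3 in the part
number. Let \<open>z(A)\<close> be the pair of its coefficients in degrees 2 and 3; it takes at most \<open>q\<^sup>2\<close>
values. If \<open>z(A) = z(B)\<close> and the parts of \<open>A\<close> and \<open>B\<close> lie in a common 5-set of parts, then
\<open>A\<close> and \<open>B\<close> do not meet in exactly two points: otherwise the two polynomials differ by a linear one
with two roots whose difference is a unit, so they agree everywhere, and \<open>A\<close> and \<open>B\<close> coincide over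
the at least three parts that they share (lemma \<open>cubics_agreeing_twice\<close>).

It remains to choose, for every 4-set \<open>J\<close> of parts and every \<open>z\<close>, a 5-set \<open>I\<close> of parts
containing \<open>J\<close> and a colour in such a way that equal colours force the 5-sets to be equal with equal
\<open>z\<close>, or to meet in at most one part. The 5-set comes from a covering design \<open>F\<close> with about
\<open>m\<^sup>4/120\<close> blocks, moved by a permutation depending on \<open>z\<close>; a colour consists of a permutation
\<open>\<pi>\<close> and a counter, and is available for the blocks of the image under \<open>\<pi>\<close> of a Steiner system
\<open>P\<close>. Since the symmetric group treats all 5-sets alike, supply and demand balance, and about
\<open>q\<^sup>2 |F|/|P|\<close>, that is \<open>q\<^sup>2 m\<^sup>2/6\<close> or \<open>n\<^sup>2/6\<close>, colours suffice (lemma \<open>ex_block_colouring\<close>).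

The remaining 4-sets contain two congruent points. There are few of them, but they crowd together:
all 4-sets through a congruent pair \<open>{u,v}\<close> are of this kind. If \<open>{u,v}\<close> is the only congruent
pair of \<open>{u,v,w,x}\<close>, then this set is bundled with those obtained by moving \<open>x\<close> within an interval of
length \<open>L\<close>; members of a bundle pairwise meet in three points. Bundling leaves only \<open>O(n\<^sup>2/L)\<close>
conflicts across the pair \<open>{u,v}\<close>, and at most \<open>O(L n q)\<close>, that is \<open>O(L n\<^sup>2/m)\<close>, across other
pairs. With \<open>m = L\<^sup>2\<close>, greedy colouring of the bundles needs \<open>O(n\<^sup>2/L)\<close> colours (lemma
\<open>colour_clashing_sets\<close>), which is negligible for large \<open>L\<close>.\<close>

section \<open>Steiner systems with blocks of size five\<close>

definition linear_5_packing :: "nat \<Rightarrow> nat set set \<Rightarrow> bool" where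
  "linear_5_packing m P \<longleftrightarrow> (\<forall>B\<in>P. B \<subseteq> {..<m} \<and> card B = 5) \<and>
     (\<forall>B\<in>P. \<forall>B'\<in>P. \<forall>x\<in>B \<inter> B'. \<forall>y\<in>B \<inter> B'. x \<noteq> y \<longrightarrow> B = B')"

text \<open>Five groups of \<open>p\<close> points: \<open>j * p, \<dots>, j * p + p - 1\<close> for \<open>j < 5\<close>. The blocks are the graphs of the affine
functions \<open>j \<mapsto> a + j b\<close> modulo \<open>p\<close>, which form a transversal design, together with a copy of the
given packing inside each group. Two different graphs meet at most once because the differences
\<open>1, \<dots>, 4\<close> of group numbers are units modulo \<open>p\<close>; this is why \<open>p\<close> is coprime to 6.\<close>

lemma linear_5_packing_step:
  assumes P: "linear_5_packing p P" and cop: "coprime p 6"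
  shows "\<exists>Q. linear_5_packing (5 * p) Q \<and> card Q = p ^ 2 + 5 * card P"
proof -
  have p: "p > 0" using cop by (cases p) auto
  define T where "T = (\<lambda>(a, b). (\<lambda>j. j * p + (a + j * b) mod p) ` {..<5})"
  define S where "S = (\<lambda>(j, B). (\<lambda>x. j * p + x) ` B)"
  define Q1 where "Q1 = T ` ({..<p} \<times> {..<p})"
  define Q2 where "Q2 = S ` ({..<5} \<times> P)"
  have PB: "B \<subseteq> {..<p}" "card B = 5" if "B \<in> P" for B
    using P that by (auto simp: linear_5_packing_def)
  have finP: "finite P"
    by (rule finite_subset[of _ "Pow {..<p}"]) (use PB in auto)
  have divT: "(j * p + (a + j * b) mod p) div p = j" for j a b
    using p by simp
  have inT: "z \<in> T (a, b) \<longleftrightarrow> z div p < 5 \<and> z mod p = (a + (z div p) * b) mod p" for z a b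
  proof
    assume "z \<in> T (a, b)"
    then show "z div p < 5 \<and> z mod p = (a + (z div p) * b) mod p"
      using p by (auto simp: T_def)
  next
    assume z: "z div p < 5 \<and> z mod p = (a + (z div p) * b) mod p"
    have "z = z div p * p + (a + z div p * b) mod p"
      using z by (metis div_mult_mod_eq)
    then show "z \<in> T (a, b)" unfolding T_def using z by auto
  qed
  have inS: "z \<in> S (j, B) \<longleftrightarrow> z div p = j \<and> z mod p \<in> B" if "B \<in> P" for z j B
  proof -
    have "x < p" if "x \<in> B" for x using PB \<open>B \<in> P\<close> that by auto
    then show ?thesis
      using p unfolding S_def by (auto simp: image_iff) (metis div_mult_mod_eq)
  qed
  have unit: "b = b' \<and> a = a'"
    if "(a + j * b) mod p = (a' + j * b') mod p" "(a + k * b) mod p = (a' + k * b') mod p"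
       "j < k" "k < 5" "a < p" "a' < p" "b < p" "b' < p" for a b a' b' j k :: nat
  proof -
    have c6: "coprime (int p) 6"
      using cop by (metis coprime_int_iff of_nat_numeral)
    have "coprime (int p) (int k - int j)"
    proof -
      have "int k - int j \<in> {1, 2, 3, 4}" using that by auto
      moreover have "coprime (int p) (2 * 3)" using c6 by simp
      then have "coprime (int p) 2" "coprime (int p) 3" by (simp_all only: coprime_mult_right_iff)
      moreover from this have "coprime (int p) (2 * 2)" by (simp only: coprime_mult_right_iff)
      ultimately show ?thesis by auto
    qed
    have e1: "int p dvd (int a + int j * int b) - (int a' + int j * int b')"
      using that(1) by (metis mod_eq_dvd_iff of_nat_add of_nat_mult zmod_int)
    have e2: "int p dvd (int a + int k * int b) - (int a' + int k * int b')"
      using that(2) by (metis mod_eq_dvd_iff of_nat_add of_nat_mult zmod_int)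
    have "int p dvd ((int a + int k * int b) - (int a' + int k * int b')) -
      ((int a + int j * int b) - (int a' + int j * int b'))"
      using e1 e2 by (rule dvd_diff[rotated])
    also have "\<dots> = (int k - int j) * (int b - int b')" by (simp add: algebra_simps)
    finally have "int p dvd int b - int b'"
      using \<open>coprime (int p) (int k - int j)\<close> coprime_dvd_mult_right_iff by blast
    then have "int b mod int p = int b' mod int p" by (simp add: mod_eq_dvd_iff)
    then have "b = b'" using that by simp
    moreover from this e1 have "int p dvd int a - int a'" by simp
    then have "int a mod int p = int a' mod int p" by (simp add: mod_eq_dvd_iff)
    then have "a = a'" using that by simp
    ultimately show ?thesis by simp
  qed
  have TT: "(a, b) = (a', b')"
    if "x \<in> T (a, b) \<inter> T (a', b')" "y \<in> T (a, b) \<inter> T (a', b')" "x \<noteq> y"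
       "a < p" "a' < p" "b < p" "b' < p" for x y a b a' b'
  proof -
    have ne: "x div p \<noteq> y div p"
      using that by (metis IntD1 div_mult_mod_eq inT)
    show ?thesis
    proof (cases "x div p < y div p")
      case True
      then show ?thesis using that unit[of a "x div p" b a' b' "y div p"] by (auto simp: inT)
    next
      case False
      then show ?thesis using ne that unit[of a "y div p" b a' b' "x div p"] by (auto simp: inT)
    qed
  qed
  have TS: "x = y" if "x \<in> T (a, b) \<inter> S (j, B)" "y \<in> T (a, b) \<inter> S (j, B)" "B \<in> P"
    for x y a b j B
    using that by (auto simp: inT inS) (metis div_mult_mod_eq)
  have SS: "(j, B) = (j', B')"
    if "x \<in> S (j, B) \<inter> S (j', B')" "y \<in> S (j, B) \<inter> S (j', B')" "x \<noteq> y" "B \<in> P" "B' \<in> P"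
    for x y j j' B B'
  proof -
    have "x mod p \<noteq> y mod p" using that by (auto simp: inS) (metis div_mult_mod_eq)
    moreover have "x mod p \<in> B \<inter> B'" "y mod p \<in> B \<inter> B'" "j = j'" using that by (auto simp: inS)
    ultimately show ?thesis using P that(4,5) unfolding linear_5_packing_def by blast
  qed
  have cardT: "card (T (a, b)) = 5" for a b
  proof -
    have "inj_on (\<lambda>j. j * p + (a + j * b) mod p) {..<5}"
      by (rule inj_onI) (metis divT)
    then show ?thesis by (simp add: T_def card_image)
  qed
  have cardS: "card (S (j, B)) = 5" if "B \<in> P" for j B
    using PB(2)[OF that] by (simp add: S_def card_image)
  have two: "\<exists>x y. x \<in> X \<and> y \<in> X \<and> x \<noteq> y" if "card X = 5" for X :: "nat set"
  proof -
    have "finite X" using that card.infinite by force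
    moreover have "\<not> card X \<le> Suc 0" using that by simp
    ultimately show ?thesis using card_le_Suc0_iff_eq by blast
  qed
  have injT: "inj_on T ({..<p} \<times> {..<p})"
  proof (rule inj_onI, clarify)
    fix a b a' b' assume *: "a < p" "b < p" "a' < p" "b' < p" "T (a, b) = T (a', b')"
    obtain x y where "x \<in> T (a, b)" "y \<in> T (a, b)" "x \<noteq> y" using two[OF cardT] by blast
    then show "a = a' \<and> b = b'" using * TT[of x a b a' b' y] by auto
  qed
  have injS: "inj_on S ({..<5} \<times> P)"
  proof (rule inj_onI, clarify)
    fix j B j' B' assume *: "B \<in> P" "B' \<in> P" "S (j, B) = S (j', B')"
    obtain x y where "x \<in> S (j, B)" "y \<in> S (j, B)" "x \<noteq> y" using two[OF cardS] * by blast
    then show "j = j' \<and> B = B'" using * SS[of x j B j' B' y] by auto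
  qed
  have disj: "Q1 \<inter> Q2 = {}"
  proof (rule ccontr)
    assume "Q1 \<inter> Q2 \<noteq> {}"
    then obtain a b j B where *: "T (a, b) = S (j, B)" "B \<in> P" unfolding Q1_def Q2_def by auto
    obtain x y where "x \<in> T (a, b)" "y \<in> T (a, b)" "x \<noteq> y" using two[OF cardT] by blast
    then show False using * TS[of x a b j B y] by auto
  qed
  have "card Q1 = p ^ 2" unfolding Q1_def by (simp add: card_image[OF injT] power2_eq_square)
  moreover have "card Q2 = 5 * card P" unfolding Q2_def by (simp add: card_image[OF injS] card_cartesian_product)
  moreover have "finite Q1" "finite Q2" unfolding Q1_def Q2_def using finP by auto
  ultimately have card: "card (Q1 \<union> Q2) = p ^ 2 + 5 * card P" by (simp add: card_Un_disjoint disj)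
  have sub5: "z < 5 * p" if "z div p < 5" for z
    using that p by (simp add: div_less_iff_less_mult)
  have "linear_5_packing (5 * p) (Q1 \<union> Q2)"
    unfolding linear_5_packing_def
  proof (rule conjI)
    show "\<forall>B\<in>Q1 \<union> Q2. B \<subseteq> {..<5 * p} \<and> card B = 5"
      using cardT cardS sub5 by (auto simp: Q1_def Q2_def inT inS)
  next
    show "\<forall>B\<in>Q1 \<union> Q2. \<forall>B'\<in>Q1 \<union> Q2. \<forall>x\<in>B \<inter> B'. \<forall>y\<in>B \<inter> B'. x \<noteq> y \<longrightarrow> B = B'"
    proof (intro ballI impI)
      fix B B' x y
      assume B: "B \<in> Q1 \<union> Q2" "B' \<in> Q1 \<union> Q2" and xy: "x \<in> B \<inter> B'" "y \<in> B \<inter> B'" "x \<noteq> y"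
      consider "B \<in> Q1" "B' \<in> Q1" | "B \<in> Q1" "B' \<in> Q2" | "B \<in> Q2" "B' \<in> Q1"
        | "B \<in> Q2" "B' \<in> Q2" using B by blast
      then show "B = B'"
      proof cases
        case 1
        then obtain a b a' b' where "a < p" "b < p" "a' < p" "b' < p" "B = T (a, b)" "B' = T (a', b')"
          unfolding Q1_def by auto
        then show ?thesis using TT[of x a b a' b' y] xy by auto
      next
        case 2
        then show ?thesis using TS xy unfolding Q1_def Q2_def by (auto 0 3)
      next
        case 3
        then show ?thesis using TS xy unfolding Q1_def Q2_def by (auto 0 3)
      next
        case 4
        then obtain j C j' C' where "C \<in> P" "C' \<in> P" "B = S (j, C)" "B' = S (j', C')"
          unfolding Q2_def by auto
        then show ?thesis using SS[of x j C j' C' y] xy by auto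
      qed
    qed
  qed
  then show ?thesis using card by blast
qed

text \<open>The number of blocks is extremal: \<open>20 |P| = m(m-1)\<close> for \<open>m = 5\<^sup>k\<close> says that every pair of points lies
in a block.\<close>

lemma ex_steiner_system_5:
  "\<exists>P. linear_5_packing (5 ^ k) P \<and> 20 * card P + 5 ^ k = (5 ^ k) ^ 2"
proof (induction k)
  case 0
  have "linear_5_packing (5 ^ 0) {}" by (simp add: linear_5_packing_def)
  then show ?case by (intro exI[of _ "{}"]) simp
next
  case (Suc k)
  then obtain P where P: "linear_5_packing (5 ^ k) P" "20 * card P + 5 ^ k = (5 ^ k) ^ 2" by blast
  have "coprime ((5::nat) ^ k) 6" using coprime_Suc_right_nat[of 5] by simp
  from linear_5_packing_step[OF P(1) this] obtain Q
    where Q: "linear_5_packing (5 * 5 ^ k) Q" "card Q = (5 ^ k) ^ 2 + 5 * card P" by blast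
  have "20 * card Q + 5 ^ Suc k = 20 * (5 ^ k) ^ 2 + 5 * (20 * card P + 5 ^ k)"
    using Q(2) by simp
  also have "\<dots> = (5 ^ Suc k) ^ 2" unfolding P(2) by (simp add: power2_eq_square)
  finally show ?case using Q(1) by auto
qed

section \<open>Covering 4-sets by 5-sets\<close>

text \<open>The 5-sets with sum divisible by \<open>m\<close> cover every 4-set at most once, and miss a 4-set only if the
element required for its completion already belongs to it. Such degenerate 4-sets are determined by three
of their elements, so completing them arbitrarily costs at most \<open>m\<^sup>3\<close> further 5-sets.\<close>

lemma ex_covering_5_of_4:
  fixes m :: nat
  assumes m: "m \<ge> 5"
  shows "\<exists>F. (\<forall>I\<in>F. I \<subseteq> {..<m} \<and> card I = 5) \<and>
     (\<forall>J. J \<subseteq> {..<m} \<and> card J = 4 \<longrightarrow> (\<exists>I\<in>F. J \<subseteq> I)) \<and>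
     5 * card F \<le> (m choose 4) + 5 * m ^ 3"
proof -
  \<comment> \<open>the unique residue that completes \<open>J\<close> to a sum divisible by \<open>m\<close>\<close>
  define r where "r J = nat ((- int (\<Sum>J)) mod int m)" for J :: "nat set"
  have r_less: "r J < m" for J unfolding r_def using m by (simp add: nat_less_iff)
  have r_unique: "x = r J" if "finite J" "x \<notin> J" "x < m" "m dvd \<Sum>(insert x J)" for x J
  proof -
    have "int m dvd int x - (- int (\<Sum>J))" 
    proof -
      have "\<Sum>(insert x J) = x + \<Sum>J" using that by simp
      then have "int m dvd int (x + \<Sum>J)" using that(4) by (simp only: int_dvd_int_iff)
      then show ?thesis by simp
    qed
    then have "int x mod int m = (- int (\<Sum>J)) mod int m" by (simp add: mod_eq_dvd_iff)
    moreover have "int x mod int m = int x" using that by simp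
    ultimately show ?thesis unfolding r_def by (metis nat_int)
  qed
  have r_sum: "m dvd r J + \<Sum>J" for J
  proof -
    have "int (r J) = (- int (\<Sum>J)) mod int m" unfolding r_def using m by simp
    then have "int (r J) mod int m = (- int (\<Sum>J)) mod int m" by simp
    then have "int m dvd int (r J + \<Sum>J)" by (simp add: mod_eq_dvd_iff)
    then show ?thesis by (simp only: int_dvd_int_iff)
  qed
  define J4 where "J4 = {J. J \<subseteq> {..<m} \<and> card J = 4}"
  define F0 where "F0 = {I. I \<subseteq> {..<m} \<and> card I = 5 \<and> m dvd \<Sum>I}"
  define D where "D = {J \<in> J4. r J \<in> J}"
  \<comment> \<open>an arbitrary completion, for degenerate 4-sets\<close>
  define e where "e J = (SOME I. I \<subseteq> {..<m} \<and> card I = 5 \<and> J \<subseteq> I)" for J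
  have e: "e J \<subseteq> {..<m} \<and> card (e J) = 5 \<and> J \<subseteq> e J" if "J \<in> J4" for J
  proof -
    have J: "J \<subseteq> {..<m}" "card J = 4" "finite J" using that finite_subset unfolding J4_def by auto
    have "card J < card {..<m}" using J m by simp
    then obtain x where "x < m" "x \<notin> J" using J by (metis card_mono lessThan_iff not_le subsetI)
    then have "insert x J \<subseteq> {..<m} \<and> card (insert x J) = 5 \<and> J \<subseteq> insert x J" using J by auto
    then show ?thesis unfolding e_def by (rule someI)
  qed
  have finJ4: "finite J4" unfolding J4_def by (rule finite_subset[of _ "Pow {..<m}"]) auto
  have finF0: "finite F0" unfolding F0_def by (rule finite_subset[of _ "Pow {..<m}"]) auto
  have finI: "finite I" if "I \<in> F0" for I using that finite_subset unfolding F0_def by auto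
  have "5 * card F0 = card (SIGMA I:F0. I)"
  proof -
    have "card (SIGMA I:F0. I) = (\<Sum>I\<in>F0. card I)" using finF0 finI by simp
    also have "\<dots> = (\<Sum>I\<in>F0. 5)" by (rule sum.cong) (auto simp: F0_def)
    finally show ?thesis by simp
  qed
  also have "\<dots> \<le> card J4"
  proof (rule card_inj_on_le[where f = "\<lambda>(I, x). I - {x}"])
    show "inj_on (\<lambda>(I, x). I - {x}) (SIGMA I:F0. I)"
    proof (rule inj_onI, clarify)
      fix I x I' x' assume *: "I \<in> F0" "x \<in> I" "I' \<in> F0" "x' \<in> I'" "I - {x} = I' - {x'}"
      have miss: "y = r (K - {y})" if "K \<in> F0" "y \<in> K" for K y
      proof (rule r_unique)
        show "finite (K - {y})" using finI that(1) by simp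
        show "y < m" using that unfolding F0_def by blast
        show "m dvd \<Sum>(insert y (K - {y}))"
          unfolding insert_Diff[OF that(2)] using that(1) unfolding F0_def by blast
      qed simp
      have "x = r (I - {x})" "x' = r (I' - {x'})" using miss * by blast+
      then have "x = x'" using *(5) by metis
      then show "I = I' \<and> x = x'" using * by (metis insert_Diff)
    qed
    show "(\<lambda>(I, x). I - {x}) ` (SIGMA I:F0. I) \<subseteq> J4"
    proof (rule image_subsetI)
      fix u assume "u \<in> (SIGMA I:F0. I)"
      then obtain I x where u: "u = (I, x)" "I \<in> F0" "x \<in> I" by blast
      then have I: "I \<subseteq> {..<m}" "card I = 5" unfolding F0_def by blast+
      have "card (I - {x}) = 4" using I(2) u(3) by simp
      then show "(case u of (I, x) \<Rightarrow> I - {x}) \<in> J4" using I(1) unfolding J4_def u(1) by auto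
    qed
  qed (rule finJ4)
  finally have F0: "5 * card F0 \<le> (m choose 4)"
    unfolding J4_def by (simp add: n_subsets)
  \<comment> \<open>\<open>a\<close> is the repeated element: \<open>2 a + b + c + d\<close> is divisible by \<open>m\<close>, so \<open>d\<close> is determined\<close>
  have "D \<subseteq> (\<lambda>(a, b, c). {a, b, c, nat ((- int (2 * a + b + c)) mod int m)}) ` ({..<m} \<times> {..<m} \<times> {..<m})"
  proof
    fix J assume "J \<in> D"
    then have J: "J \<subseteq> {..<m}" "card J = 4" "r J \<in> J" unfolding D_def J4_def by auto
    then have "card (J - {r J}) = 3" by simp
    then obtain b c d where bcd: "J - {r J} = {b, c, d}" "b \<noteq> c" "b \<noteq> d" "c \<noteq> d"
      by (auto simp: card_3_iff)
    then have Jeq: "J = {r J, b, c, d}" "r J \<notin> {b, c, d}" using J(3) by blast+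
    have "\<Sum>J = r J + b + c + d"
    proof -
      have "\<Sum>J = \<Sum>{r J, b, c, d}" using Jeq(1) by simp
      then show ?thesis using bcd(2-4) Jeq(2) by simp
    qed
    then have "int m dvd int (r J + (r J + b + c + d))" using r_sum[of J] by (metis int_dvd_int_iff)
    then have "int m dvd int d - (- int (2 * r J + b + c))" by (simp add: algebra_simps)
    then have "int d mod int m = (- int (2 * r J + b + c)) mod int m" by (simp add: mod_eq_dvd_iff)
    moreover have "d < m" "b < m" "c < m" using J(1) Jeq(1) by auto
    moreover from \<open>d < m\<close> have "int d mod int m = int d" by simp
    ultimately have "d = nat ((- int (2 * r J + b + c)) mod int m)" by (metis nat_int)
    then show "J \<in> (\<lambda>(a, b, c). {a, b, c, nat ((- int (2 * a + b + c)) mod int m)}) ` ({..<m} \<times> {..<m} \<times> {..<m})"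
      using Jeq(1) \<open>b < m\<close> \<open>c < m\<close> r_less[of J] by (intro image_eqI[of _ _ "(r J, b, c)"]) auto
  qed
  then have "card D \<le> card ({..<m} \<times> {..<m} \<times> {..<m})"
    by (rule surj_card_le[rotated]) simp
  then have D: "card D \<le> m ^ 3" by (simp add: power3_eq_cube)
  have finD: "finite D" using finJ4 unfolding D_def by simp
  define F where "F = F0 \<union> e ` D"
  have "card F \<le> card F0 + card (e ` D)" unfolding F_def by (rule card_Un_le)
  also have "\<dots> \<le> card F0 + m ^ 3" using D card_image_le[OF finD, of e] by linarith
  finally have "5 * card F \<le> (m choose 4) + 5 * m ^ 3" using F0 by linarith
  moreover have "\<exists>I\<in>F. J \<subseteq> I" if J: "J \<subseteq> {..<m}" "card J = 4" for J
  proof (cases "r J \<in> J")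
    case True
    then have "J \<in> D" using J by (simp add: D_def J4_def)
    then show ?thesis using e[of J] unfolding F_def D_def by blast
  next
    case False
    have "finite J" using J finite_subset by blast
    then have "insert (r J) J \<in> F0" using False J r_less r_sum by (simp add: F0_def)
    then show ?thesis unfolding F_def by blast
  qed
  moreover have "\<forall>I\<in>F. I \<subseteq> {..<m} \<and> card I = 5" using e unfolding F_def F0_def D_def by auto
  ultimately show ?thesis by blast
qed

section \<open>Averaging over the symmetric group\<close>

lemma ex_permutes_image:
  assumes V: "finite V" and I: "I \<subseteq> V" "I' \<subseteq> V" "card I = card I'"
  shows "\<exists>\<tau>. \<tau> permutes V \<and> \<tau> ` I = I'"
proof -
  have fin: "finite I" "finite I'" using I V finite_subset by auto
  obtain g where g: "bij_betw g I I'"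
    using finite_same_card_bij fin I(3) by blast
  have "card (V - I) = card (V - I')" using I fin by (simp add: card_Diff_subset)
  then obtain h where h: "bij_betw h (V - I) (V - I')"
    using finite_same_card_bij V by (metis finite_Diff)
  define \<tau> where "\<tau> x = (if x \<in> I then g x else if x \<in> V then h x else x)" for x
  have 1: "bij_betw \<tau> I I'" using g by (rule bij_betw_cong[THEN iffD1, rotated]) (simp add: \<tau>_def)
  have 2: "bij_betw \<tau> (V - I) (V - I')"
    using h by (rule bij_betw_cong[THEN iffD1, rotated]) (simp add: \<tau>_def)
  have "bij_betw \<tau> (I \<union> (V - I)) (I' \<union> (V - I'))"
    using 1 2 by (rule bij_betw_combine) auto
  moreover have "I \<union> (V - I) = V" "I' \<union> (V - I') = V" using I by auto
  ultimately have "bij_betw \<tau> V V" by simp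
  then have "\<tau> permutes V" by (rule bij_imp_permutes) (use I in \<open>auto simp: \<tau>_def\<close>)
  then show ?thesis using 1 by (auto simp: bij_betw_def)
qed

text \<open>The number of permutations carrying some member of \<open>F\<close> to \<open>I\<close> is the same for all \<open>r\<close>-sets \<open>I\<close>,
as left multiplication by a permutation moving \<open>I\<close> to another \<open>r\<close>-set shows. Its value
follows by double counting.\<close>

lemma card_permutations_hitting:
  fixes F :: "'a set set"
  assumes V: "finite V" and F: "\<And>B. B \<in> F \<Longrightarrow> B \<subseteq> V \<and> card B = r"
    and I: "I \<subseteq> V" "card I = r"
  shows "card {\<sigma>. \<sigma> permutes V \<and> I \<in> (`) \<sigma> ` F} * (card V choose r) = fact (card V) * card F"
proof -
  define G where "G = {\<sigma>. \<sigma> permutes V}"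
  define N where "N I = card {\<sigma> \<in> G. I \<in> (`) \<sigma> ` F}" for I
  define R where "R = {B. B \<subseteq> V \<and> card B = r}"
  have finG: "finite G" unfolding G_def using V by (rule finite_permutations)
  have finR: "finite R" unfolding R_def using V by simp
  have le: "N I \<le> N I'" if I: "I \<in> R" "I' \<in> R" for I I'
  proof -
    obtain \<tau> where \<tau>: "\<tau> permutes V" "\<tau> ` I = I'"
      using ex_permutes_image[of V I I'] V I unfolding R_def by auto
    show ?thesis
      unfolding N_def
    proof (rule card_inj_on_le[where f = "\<lambda>\<sigma>. \<tau> \<circ> \<sigma>"])
      show "inj_on ((\<circ>) \<tau>) {\<sigma> \<in> G. I \<in> (`) \<sigma> ` F}"
        using permutes_inj[OF \<tau>(1)] by (auto intro!: inj_onI simp: fun_eq_iff inj_def)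
      show "(\<circ>) \<tau> ` {\<sigma> \<in> G. I \<in> (`) \<sigma> ` F} \<subseteq> {\<sigma> \<in> G. I' \<in> (`) \<sigma> ` F}"
      proof (rule image_subsetI)
        fix \<sigma> assume "\<sigma> \<in> {\<sigma> \<in> G. I \<in> (`) \<sigma> ` F}"
        then obtain B where "\<sigma> permutes V" "B \<in> F" "I = \<sigma> ` B" by (auto simp: G_def)
        then show "\<tau> \<circ> \<sigma> \<in> {\<sigma> \<in> G. I' \<in> (`) \<sigma> ` F}"
          using \<tau> permutes_compose[of \<sigma> V \<tau>] by (auto simp: G_def image_comp)
      qed
      show "finite {\<sigma> \<in> G. I' \<in> (`) \<sigma> ` F}" using finG by simp
    qed
  qed
  have IR: "I \<in> R" using I by (simp add: R_def)
  have "(\<Sum>\<sigma>\<in>G. card {B \<in> R. B \<in> (`) \<sigma> ` F}) = N I * card R"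
  proof (rule sum_multicount[OF finG finR])
    show "\<forall>B\<in>R. card {\<sigma> \<in> G. B \<in> (`) \<sigma> ` F} = N I"
      using le IR unfolding N_def by (meson order_antisym)
  qed
  moreover have "card {B \<in> R. B \<in> (`) \<sigma> ` F} = card F" if "\<sigma> \<in> G" for \<sigma>
  proof -
    have \<sigma>: "\<sigma> permutes V" using that by (simp add: G_def)
    have inj: "inj \<sigma>" using \<sigma> by (rule permutes_inj)
    have "\<sigma> ` B \<in> R" if "B \<in> F" for B
    proof -
      have "card (\<sigma> ` B) = card B" using inj by (meson card_image inj_on_subset subset_UNIV)
      moreover have "\<sigma> ` B \<subseteq> V" using F[OF that] permutes_image[OF \<sigma>] by blast
      ultimately show ?thesis using F[OF that] by (simp add: R_def)
    qed
    then have "{B \<in> R. B \<in> (`) \<sigma> ` F} = (`) \<sigma> ` F" by auto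
    moreover have "inj_on ((`) \<sigma>) F" using inj by (meson inj_image_eq_iff inj_onI)
    ultimately show ?thesis by (simp add: card_image)
  qed
  ultimately have "card G * card F = N I * card R" by simp
  moreover have "card G = fact (card V)" unfolding G_def using V by (simp add: card_permutations)
  moreover have "card R = card V choose r" unfolding R_def using V by (simp add: n_subsets)
  ultimately show ?thesis unfolding N_def G_def by simp
qed

lemma ex_balanced_map:
  assumes Z: "finite Z" and G: "finite G" "G \<noteq> {}"
  shows "\<exists>h. (\<forall>z\<in>Z. h z \<in> G) \<and> (\<forall>g\<in>G. card {z \<in> Z. h z = g} \<le> card Z div card G + 1)"
proof -
  define k where "k = card G"
  have k: "k > 0" using G by (simp add: k_def card_gt_0_iff)
  obtain e where e: "bij_betw e Z {0..<card Z}" using ex_bij_betw_finite_nat[OF Z] by blast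
  obtain e' where e': "bij_betw e' {0..<k} G"
    unfolding k_def using ex_bij_betw_nat_finite[OF G(1)] by blast
  define h where "h z = e' (e z mod k)" for z
  have "h z \<in> G" for z unfolding h_def using e' k by (auto simp: bij_betw_def)
  moreover have "card {z \<in> Z. h z = g} \<le> card Z div k + 1" for g
  proof -
    have same: "e z mod k = e z' mod k" if "h z = h z'" for z z'
      using e' k that unfolding h_def bij_betw_def by (auto dest: inj_onD)
    have "card {z \<in> Z. h z = g} \<le> card {..card Z div k}"
    proof (rule card_inj_on_le[where f = "\<lambda>z. e z div k"])
      show "inj_on (\<lambda>z. e z div k) {z \<in> Z. h z = g}"
      proof (rule inj_onI)
        fix z z' assume *: "z \<in> {z \<in> Z. h z = g}" "z' \<in> {z \<in> Z. h z = g}" "e z div k = e z' div k"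
        then have "e z = e z'" using same[of z z'] by (metis (mono_tags, lifting) div_mult_mod_eq mem_Collect_eq)
        then show "z = z'" using * e by (auto simp: bij_betw_def dest: inj_onD)
      qed
      show "(\<lambda>z. e z div k) ` {z \<in> Z. h z = g} \<subseteq> {..card Z div k}"
      proof (rule image_subsetI)
        fix z assume "z \<in> {z \<in> Z. h z = g}"
        then have "e z < card Z" using bij_betwE[OF e] by simp
        then show "e z div k \<in> {..card Z div k}" by (simp add: div_le_mono)
      qed
    qed simp
    then show ?thesis by simp
  qed
  ultimately show ?thesis unfolding k_def by blast
qed

text \<open>The averaging step, in general form. Every \<open>z\<close> is assigned a permutation \<open>h z\<close>, each
permutation being used about equally often, and a set \<open>J\<close> is extended to a member \<open>ext J z\<close> of the
image of the covering \<open>F\<close> under \<open>h z\<close>. By \<open>card_permutations_hitting\<close> each \<open>r\<close>-set \<open>I\<close> is then demanded by at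
most about \<open>|Z| |F| / C\<close> elements \<open>z\<close>, where \<open>C\<close> is the number of \<open>r\<close>-sets. A colour is a pair of a
permutation \<open>\<pi>\<close> and a counter below \<open>S\<close>, and \<open>I\<close> may use it if \<open>I\<close> is in the image of \<open>P\<close> under \<open>\<pi>\<close>;
so \<open>S |V|! |P| / C\<close> colours are available to \<open>I\<close>. It suffices to take \<open>S\<close> just large enough to
inject demand into supply, for each \<open>I\<close> separately. Sets \<open>I\<close> and \<open>I'\<close> using the same colour lie in
one image of \<open>P\<close>, so if they share two points they are equal, and injectivity recovers \<open>z\<close>.\<close>

lemma ex_block_colouring:
  fixes F P :: "'a set set" and Z :: "'z set"
  assumes V: "finite V" and r: "r \<le> card V"
    and P: "\<And>B. B \<in> P \<Longrightarrow> B \<subseteq> V \<and> card B = r" "P \<noteq> {}"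
    and lin: "\<And>B B' x y. B \<in> P \<Longrightarrow> B' \<in> P \<Longrightarrow> x \<in> B \<inter> B' \<Longrightarrow> y \<in> B \<inter> B' \<Longrightarrow> x \<noteq> y \<Longrightarrow> B = B'"
    and F: "\<And>I. I \<in> F \<Longrightarrow> I \<subseteq> V \<and> card I = r"
    and cover: "\<And>J. J \<subseteq> V \<Longrightarrow> card J = s \<Longrightarrow> \<exists>I\<in>F. J \<subseteq> I"
    and Z: "finite Z"
  obtains K :: nat and ext :: "'a set \<Rightarrow> 'z \<Rightarrow> 'a set" and col :: "'a set \<Rightarrow> 'z \<Rightarrow> nat" where
    "real K \<le> (card Z + fact (card V)) * (card F / card P) + fact (card V)"
    "\<And>J z. J \<subseteq> V \<Longrightarrow> card J = s \<Longrightarrow> z \<in> Z \<Longrightarrow>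
       J \<subseteq> ext J z \<and> card (ext J z) = r \<and> col J z < K"
    "\<And>J z J' z' x y. \<lbrakk>J \<subseteq> V; card J = s; z \<in> Z; J' \<subseteq> V; card J' = s; z' \<in> Z;
       col J z = col J' z'; x \<in> J \<inter> J'; y \<in> J \<inter> J'; x \<noteq> y\<rbrakk> \<Longrightarrow> ext J z = ext J' z' \<and> z = z'"
proof -
  define G where "G = {\<sigma>. \<sigma> permutes V}"
  have G: "finite G" "card G = fact (card V)"
    unfolding G_def using V by (simp_all add: finite_permutations card_permutations)
  then have "G \<noteq> {}" by (metis card.empty fact_nonzero)
  obtain h where h: "\<And>z. z \<in> Z \<Longrightarrow> h z \<in> G"
    "\<And>\<sigma>. \<sigma> \<in> G \<Longrightarrow> card {z \<in> Z. h z = \<sigma>} \<le> card Z div card G + 1"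
    using ex_balanced_map[OF Z G(1) \<open>G \<noteq> {}\<close>] by blast
  define N where "N Q I = {\<sigma> \<in> G. I \<in> (`) \<sigma> ` Q}" for Q :: "'a set set" and I
  define C where "C = card V choose r"
  have C: "C > 0" unfolding C_def using r by simp
  have finP: "finite P"
    by (rule finite_subset[of _ "Pow V"]) (use P V in auto)
  have NP: "card (N P I) * C = fact (card V) * card P" if "I \<subseteq> V" "card I = r" for I
    unfolding N_def G_def C_def mem_Collect_eq
    by (rule card_permutations_hitting) (use V P that in auto)
  have NF: "card (N F I) * C = fact (card V) * card F" if "I \<subseteq> V" "card I = r" for I
    unfolding N_def G_def C_def mem_Collect_eq
    by (rule card_permutations_hitting) (use V F that in auto)
  define nP where "nP = fact (card V) * card P div C"
  define nF where "nF = fact (card V) * card F div C"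
  have nP: "card (N P I) = nP" if "I \<subseteq> V" "card I = r" for I
    unfolding nP_def NP[OF that, symmetric] using C by simp
  have nF: "card (N F I) = nF" if "I \<subseteq> V" "card I = r" for I
    unfolding nF_def NF[OF that, symmetric] using C by simp
  obtain I0 where I0: "I0 \<subseteq> V" "card I0 = r" using r by (meson obtain_subset_with_card_n)
  have eqP: "nP * C = fact (card V) * card P" using NP nP I0 by metis
  have eqF: "nF * C = fact (card V) * card F" using NF nF I0 by metis
  have "card P > 0" using P(2) finP by (simp add: card_gt_0_iff)
  then have nP0: "nP > 0" using eqP by (metis fact_nonzero gr0I mult_is_0 nat_neq_iff)
  \<comment> \<open>bound on the number of \<open>z\<close> sharing a permutation\<close>
  define a where "a = card Z div card G + 1"
  define S where "S = a * nF div nP + 1"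
  \<comment> \<open>the elements \<open>z\<close> that may demand \<open>I\<close>\<close>
  define ZI where "ZI I = {z \<in> Z. I \<in> (`) (h z) ` F}" for I
  have ZI_card: "card (ZI I) \<le> card (N P I \<times> {..<S})" if I: "I \<subseteq> V" "card I = r" for I
  proof -
    have "ZI I \<subseteq> (\<Union>\<sigma>\<in>N F I. {z \<in> Z. h z = \<sigma>})"
      unfolding ZI_def N_def using h(1) by auto
    then have "card (ZI I) \<le> card (\<Union>\<sigma>\<in>N F I. {z \<in> Z. h z = \<sigma>})"
      by (rule card_mono[rotated]) (use Z in \<open>auto intro: finite_subset\<close>)
    also have "\<dots> \<le> (\<Sum>\<sigma>\<in>N F I. card {z \<in> Z. h z = \<sigma>})"
      by (rule card_UN_le) (simp add: N_def G)
    also have "\<dots> \<le> (\<Sum>\<sigma>\<in>N F I. a)"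
      unfolding a_def by (rule sum_mono) (simp add: N_def h(2)[simplified])
    also have "\<dots> = a * nF" using nF[OF I] by simp
    also have "\<dots> \<le> nP * S"
      using dividend_less_times_div[OF nP0, of "a * nF"] by (simp add: S_def)
    also have "\<dots> = card (N P I \<times> {..<S})" using nP[OF I] by (simp add: card_cartesian_product)
    finally show ?thesis .
  qed
  have "\<forall>I. \<exists>f. I \<subseteq> V \<and> card I = r \<longrightarrow> f ` ZI I \<subseteq> N P I \<times> {..<S} \<and> inj_on f (ZI I)"
  proof
    fix I
    show "\<exists>f. I \<subseteq> V \<and> card I = r \<longrightarrow> f ` ZI I \<subseteq> N P I \<times> {..<S} \<and> inj_on f (ZI I)"
    proof (cases "I \<subseteq> V \<and> card I = r")
      case True
      have "\<exists>f. f ` ZI I \<subseteq> N P I \<times> {..<S} \<and> inj_on f (ZI I)"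
        by (rule card_le_inj) (use ZI_card True Z G in \<open>auto simp: ZI_def N_def\<close>)
      then show ?thesis by blast
    qed blast
  qed
  then obtain \<psi> where \<psi>: "\<And>I. I \<subseteq> V \<Longrightarrow> card I = r \<Longrightarrow> \<psi> I ` ZI I \<subseteq> N P I \<times> {..<S}"
    "\<And>I. I \<subseteq> V \<Longrightarrow> card I = r \<Longrightarrow> inj_on (\<psi> I) (ZI I)" by metis
  obtain e where e: "bij_betw e (G \<times> {..<S}) {0..<card (G \<times> {..<S})}"
    using ex_bij_betw_finite_nat[of "G \<times> {..<S}"] G by blast
  define K where "K = card (G \<times> {..<S})"
  define ext where "ext J z = (SOME I. I \<in> (`) (h z) ` F \<and> J \<subseteq> I)" for J z
  define col where "col J z = e (\<psi> (ext J z) z)" for J z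
  have ext: "ext J z \<in> (`) (h z) ` F \<and> J \<subseteq> ext J z" if J: "J \<subseteq> V" "card J = s" "z \<in> Z" for J z
  proof -
    have \<sigma>: "h z permutes V" using h(1)[OF J(3)] by (simp add: G_def)
    have inv: "inv (h z) permutes V" using \<sigma> by (rule permutes_inv)
    have "inv (h z) ` J \<subseteq> V" using J(1) permutes_image[OF inv] by blast
    moreover have "card (inv (h z) ` J) = s"
      using J(2) permutes_inj[OF inv] by (metis card_image inj_on_subset subset_UNIV)
    ultimately obtain B where B: "B \<in> F" "inv (h z) ` J \<subseteq> B" using cover by blast
    have "J = h z ` inv (h z) ` J"
      using permutes_surj[OF \<sigma>] by (simp add: image_f_inv_f)
    then have "h z ` B \<in> (`) (h z) ` F \<and> J \<subseteq> h z ` B" using B by blast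
    then show ?thesis unfolding ext_def by (rule someI)
  qed
  have ext': "ext J z \<subseteq> V \<and> card (ext J z) = r \<and> z \<in> ZI (ext J z)"
    if J: "J \<subseteq> V" "card J = s" "z \<in> Z" for J z
  proof -
    have \<sigma>: "h z permutes V" using h(1)[OF J(3)] by (simp add: G_def)
    obtain B where B: "B \<in> F" "ext J z = h z ` B" using ext[OF J] by blast
    have "ext J z \<subseteq> V" using B F permutes_image[OF \<sigma>] by blast
    moreover have "card (ext J z) = r"
      using B F permutes_inj[OF \<sigma>] by (metis card_image inj_on_subset subset_UNIV)
    ultimately show ?thesis using ext[OF J] J(3) by (simp add: ZI_def)
  qed
  show ?thesis
  proof (rule that)
    have rP: "real nP * real C = fact (card V) * card P" using eqP by (metis of_nat_fact of_nat_mult)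
    have rF: "real nF * real C = fact (card V) * card F" using eqF by (metis of_nat_fact of_nat_mult)
    have "real S \<le> real (a * nF) / real nP + 1"
      unfolding S_def using of_nat_div_le_of_nat[of "a * nF" nP, where 'a = real] by simp
    also have "\<dots> = real a * (real nF / real nP) + 1" by simp
    also have "real nF / real nP = (real nF * real C) / (real nP * real C)" using C by simp
    also have "\<dots> = (fact (card V) * card F) / (fact (card V) * card P)"
      by (simp only: rP rF)
    also have "\<dots> = card F / card P" by simp
    finally have S: "real S \<le> real a * (card F / card P) + 1" .
    have "real (card Z div card G) \<le> real (card Z) / real (card G)" by (rule of_nat_div_le_of_nat)
    then have a: "fact (card V) * real a \<le> card Z + fact (card V)"
      unfolding a_def G by (simp add: field_simps)
    have "real K = fact (card V) * real S" by (simp add: K_def card_cartesian_product G)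
    also have "\<dots> \<le> fact (card V) * (real a * (card F / card P) + 1)"
      using S by (rule mult_left_mono) simp
    also have "\<dots> = (fact (card V) * real a) * (card F / card P) + fact (card V)"
      by (simp add: algebra_simps)
    also have "\<dots> \<le> (card Z + fact (card V)) * (card F / card P) + fact (card V)"
      using a by (intro add_right_mono mult_right_mono) simp_all
    finally show "real K \<le> (card Z + fact (card V)) * (card F / card P) + fact (card V)" .
  next
    fix J z assume J: "J \<subseteq> V" "card J = s" "z \<in> Z"
    have "\<psi> (ext J z) z \<in> N P (ext J z) \<times> {..<S}"
      using \<psi>(1)[of "ext J z"] ext'[OF J] by blast
    then have "\<psi> (ext J z) z \<in> G \<times> {..<S}" by (auto simp: N_def)
    then have "col J z < K" using bij_betwE[OF e] unfolding col_def K_def by auto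
    then show "J \<subseteq> ext J z \<and> card (ext J z) = r \<and> col J z < K"
      using ext[OF J] ext'[OF J] by blast
  next
    fix J z J' z' x y
    assume J: "J \<subseteq> V" "card J = s" "z \<in> Z" and J': "J' \<subseteq> V" "card J' = s" "z' \<in> Z"
      and eq: "col J z = col J' z'" and xy: "x \<in> J \<inter> J'" "y \<in> J \<inter> J'" "x \<noteq> y"
    have m: "\<psi> (ext J z) z \<in> N P (ext J z) \<times> {..<S}" "\<psi> (ext J' z') z' \<in> N P (ext J' z') \<times> {..<S}"
      using \<psi>(1) ext'[OF J] ext'[OF J'] by blast+
    then have "\<psi> (ext J z) z = \<psi> (ext J' z') z'"
      using eq e unfolding col_def bij_betw_def by (auto simp: N_def dest!: inj_onD)
    then obtain \<pi> t where \<pi>: "\<psi> (ext J z) z = (\<pi>, t)" "\<pi> \<in> N P (ext J z)" "\<pi> \<in> N P (ext J' z')"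
      using m by (metis mem_Sigma_iff surj_pair)
    then obtain B B' where B: "B \<in> P" "ext J z = \<pi> ` B" "B' \<in> P" "ext J' z' = \<pi> ` B'" "\<pi> permutes V"
      unfolding N_def G_def by blast
    have inj: "inj \<pi>" using B(5) by (rule permutes_inj)
    have "x \<in> \<pi> ` (B \<inter> B')" "y \<in> \<pi> ` (B \<inter> B')"
      using xy ext[OF J] ext[OF J'] B unfolding image_Int[OF inj] by auto
    then have "B = B'" using lin[OF B(1,3)] xy(3) by blast
    then have "ext J z = ext J' z'" using B by simp
    moreover from this have "z = z'"
      using \<psi>(2)[of "ext J z"] ext'[OF J] ext'[OF J'] \<open>\<psi> (ext J z) z = \<psi> (ext J' z') z'\<close>
      by (metis inj_onD)
    ultimately show "ext J z = ext J' z' \<and> z = z'" by blast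
  qed
qed

section \<open>Greedy colouring of the sets with congruent points\<close>

lemma greedy_colouring:
  assumes "finite V" and sym: "\<And>u v. R u v \<Longrightarrow> R v u"
    and "\<And>v. v \<in> V \<Longrightarrow> card {u \<in> V. u \<noteq> v \<and> R v u} \<le> d"
  shows "\<exists>c :: 'a \<Rightarrow> nat. (\<forall>v\<in>V. c v \<le> d) \<and> (\<forall>u\<in>V. \<forall>v\<in>V. u \<noteq> v \<and> R u v \<longrightarrow> c u \<noteq> c v)"
  using assms(1,3)
proof (induction V rule: finite_induct)
  case empty
  then show ?case by simp
next
  case (insert w V)
  have "card {u \<in> V. u \<noteq> v \<and> R v u} \<le> d" if "v \<in> V" for v
  proof -
    have "card {u \<in> V. u \<noteq> v \<and> R v u} \<le> card {u \<in> insert w V. u \<noteq> v \<and> R v u}"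
      by (rule card_mono) (use insert.hyps in auto)
    also have "\<dots> \<le> d" using insert.prems that by blast
    finally show ?thesis .
  qed
  then obtain c :: "'a \<Rightarrow> nat" where c: "\<And>v. v \<in> V \<Longrightarrow> c v \<le> d"
    "\<And>u v. u \<in> V \<Longrightarrow> v \<in> V \<Longrightarrow> u \<noteq> v \<Longrightarrow> R u v \<Longrightarrow> c u \<noteq> c v"
    using insert.IH by blast
  define B where "B = {u \<in> V. R w u}"
  have "{u \<in> insert w V. u \<noteq> w \<and> R w u} = B" using insert.hyps by (auto simp: B_def)
  then have "card B \<le> d" using insert.prems[of w] by simp
  moreover have "finite B" using insert.hyps by (simp add: B_def)
  ultimately have "card (c ` B) < card {..d}"
    using card_image_le[of B c] by simp
  then have "\<not> {..d} \<subseteq> c ` B"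
    using \<open>finite B\<close> by (meson card_mono finite_imageI not_le)
  then obtain t where t: "t \<le> d" "t \<notin> c ` B" by auto
  have "\<forall>v\<in>insert w V. (c(w := t)) v \<le> d" using t c(1) by auto
  moreover have "(c(w := t)) u \<noteq> (c(w := t)) v"
    if "u \<in> insert w V" "v \<in> insert w V" "u \<noteq> v" "R u v" for u v
  proof -
    have "c x \<noteq> t" if "x \<in> V" "R w x" for x using that t(2) by (auto simp: B_def)
    then show ?thesis using that c(2)[of u v] sym[of u v] by (auto dest: not_sym)
  qed
  ultimately show ?case by blast
qed

definition clashing :: "('a \<Rightarrow> 'b) \<Rightarrow> 'a set \<Rightarrow> 'a set" where
  "clashing f A = {x \<in> A. \<exists>y\<in>A. y \<noteq> x \<and> f y = f x}"

lemma card_4_remove_2: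
  assumes "card A = 4" "s \<subseteq> A" "card s = 2" "w \<in> A" "w \<notin> s"
  obtains w' where "A - s = {w, w'}" "w \<noteq> w'"
proof -
  have "finite A" using assms(1) card.infinite by force
  then have "card (A - s) = 2" using assms by (simp add: card_Diff_subset finite_subset)
  moreover have "w \<in> A - s" using assms by simp
  ultimately have "card (A - s - {w}) = 1" by simp
  then obtain w' where w': "A - s - {w} = {w'}" by (auto simp: card_1_singleton_iff)
  then have "A - s = {w, w'}" using insert_Diff[OF \<open>w \<in> A - s\<close>] by simp
  moreover have "w \<noteq> w'" using w' by auto
  ultimately show ?thesis by (rule that)
qed

lemma clashing_pair:
  assumes s: "card s = 2" "s \<subseteq> A" and ne: "clashing f A \<noteq> s" "\<not> inj_on f A"
  obtains w where "w \<in> A" "w \<notin> s" "\<exists>y\<in>A. y \<noteq> w \<and> f y = f w"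
proof -
  have "\<not> clashing f A \<subseteq> s"
  proof
    assume sub: "clashing f A \<subseteq> s"
    obtain x y where xy: "x \<in> A" "y \<in> A" "x \<noteq> y" "f x = f y"
      using ne(2) by (auto simp: inj_on_def)
    then have "{x, y} \<subseteq> clashing f A" by (auto simp: clashing_def)
    moreover have "card {x, y} = card s" using xy s by simp
    moreover have "finite s" using s card.infinite by force
    ultimately have "{x, y} = s" using sub by (meson card_subset_eq order_trans)
    then show False using sub ne(1) \<open>{x, y} \<subseteq> clashing f A\<close> by blast
  qed
  then show ?thesis using that by (auto simp: clashing_def)
qed

text \<open>The two points outside \<open>s\<close> cannot be chosen freely: one of them lies in the fibre of a point of \<open>s\<close> or
of the other one. Without the condition \<open>clashing f A \<noteq> s\<close> there would be about \<open>n\<^sup>2/2\<close> sets through a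
clashing pair \<open>s\<close>.\<close>

lemma card_clash_off_pair:
  fixes f :: "nat \<Rightarrow> nat"
  assumes V: "finite V" "card V = n" and fib: "\<And>v. v \<in> V \<Longrightarrow> card {u \<in> V. f u = f v} \<le> q"
    and s: "card s = 2"
  shows "card {A. A \<subseteq> V \<and> card A = 4 \<and> \<not> inj_on f A \<and> s \<subseteq> A \<and> clashing f A \<noteq> s} \<le> 3 * n * q"
    (is "card ?X \<le> _")
proof (cases "s \<subseteq> V")
  case False
  then have "?X = {}" by blast
  then show ?thesis by (metis card.empty le0)
next
  case True
  obtain a b where ab: "s = {a, b}" "a \<noteq> b" using s by (auto simp: card_2_iff)
  have abV: "a \<in> V" "b \<in> V" using True ab by auto
  define Fib where "Fib v = {u \<in> V. f u = f v}" for v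
  define Y where "Y = (Fib a \<times> V) \<union> (Fib b \<times> V) \<union> (SIGMA y:V. Fib y)"
  have finFib: "finite (Fib v)" for v using V by (simp add: Fib_def)
  have Fib: "card (Fib v) \<le> q" if "v \<in> V" for v using fib[OF that] by (simp add: Fib_def)
  have "?X \<subseteq> (\<lambda>(y, y'). {a, b, y, y'}) ` Y"
  proof
    fix A assume "A \<in> ?X"
    then have A: "A \<subseteq> V" "card A = 4" "\<not> inj_on f A" "s \<subseteq> A" "clashing f A \<noteq> s" by auto
    obtain w where w: "w \<in> A" "w \<notin> s" "\<exists>y\<in>A. y \<noteq> w \<and> f y = f w"
      using clashing_pair[OF s A(4,5,3)] by blast
    obtain w' where w': "A - s = {w, w'}" using card_4_remove_2[OF A(2,4) s w(1,2)] .
    have "A = s \<union> {w, w'}" unfolding w'[symmetric] using A(4) by blast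
    also have "\<dots> = {a, b, w, w'}" unfolding ab(1) by auto
    finally have Aeq: "A = {a, b, w, w'}" .
    have wV: "w \<in> V" "w' \<in> V" using A(1) Aeq by auto
    obtain t where t: "t \<in> A" "t \<noteq> w" "f t = f w" using w by blast
    then have "(w, w') \<in> Y"
      using Aeq wV by (auto simp: Y_def Fib_def)
    then show "A \<in> (\<lambda>(y, y'). {a, b, y, y'}) ` Y" using Aeq by (intro image_eqI) auto
  qed
  then have "card ?X \<le> card Y"
    by (rule surj_card_le[rotated]) (use V finFib in \<open>auto simp: Y_def\<close>)
  also have "\<dots> \<le> card (Fib a \<times> V) + card (Fib b \<times> V) + card (SIGMA y:V. Fib y)"
    unfolding Y_def by (meson add_le_mono card_Un_le order_refl order_trans)
  also have "\<dots> \<le> q * n + q * n + q * n"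
  proof (intro add_mono)
    show "card (Fib a \<times> V) \<le> q * n" "card (Fib b \<times> V) \<le> q * n"
      using Fib abV V by (simp_all add: card_cartesian_product)
    have "card (SIGMA y:V. Fib y) = (\<Sum>y\<in>V. card (Fib y))" using V finFib by simp
    also have "\<dots> \<le> (\<Sum>y\<in>V. q)" using Fib by (rule sum_mono)
    finally show "card (SIGMA y:V. Fib y) \<le> q * n" using V by (simp add: mult.commute)
  qed
  also have "\<dots> = 3 * n * q" by simp
  finally show ?thesis .
qed

text \<open>Greedy colouring of bundles. A bundle is given by its key: if exactly two points \<open>u\<close>, \<open>v\<close> of \<open>A\<close> clash,
the key forgets the larger point \<open>x\<close> of the other two and records only the interval of length \<open>L\<close>
containing it; otherwise the key is \<open>A\<close> itself. A bundle has at most \<open>L\<close> members, and members of one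
bundle never meet in exactly two points.

Let \<open>A\<close> in a given bundle meet \<open>A'\<close> in a pair \<open>s\<close>. If \<open>s\<close> is exactly the set of clashing points of
\<open>A'\<close>, then \<open>s\<close> consists of points that clash in \<open>A\<close>; the bundle determines these, so there are at most
six such \<open>s\<close>, each lying in at most \<open>n (n div L + 1)\<close> bundles of this kind. Otherwise
\<open>card_clash_off_pair\<close> bounds the number of \<open>A'\<close> by \<open>3 n q\<close> for each of at most \<open>L\<close> sets \<open>A\<close> and six pairs \<open>s\<close>.\<close>

lemma colour_clashing_sets:
  fixes f :: "nat \<Rightarrow> nat" and n q L :: nat
  assumes fib: "\<And>v. v \<in> {1..n} \<Longrightarrow> card {u \<in> {1..n}. f u = f v} \<le> q" and L: "L > 0"
  shows "\<exists>c :: nat set \<Rightarrow> nat.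
    (\<forall>A. A \<subseteq> {1..n} \<and> card A = 4 \<and> \<not> inj_on f A \<longrightarrow> c A \<le> 18 * L * n * q + 6 * n * (n div L + 1)) \<and>
    (\<forall>A B. A \<subseteq> {1..n} \<and> card A = 4 \<and> \<not> inj_on f A \<and> B \<subseteq> {1..n} \<and> card B = 4 \<and> \<not> inj_on f B \<and>
       card (A \<inter> B) = 2 \<longrightarrow> c A \<noteq> c B)"
proof -
  define \<A> where "\<A> = {A. A \<subseteq> {1..n} \<and> card A = 4 \<and> \<not> inj_on f A}"
  define W where "W = clashing f"
  define x where "x A = Max (A - W A)" for A
  \<comment> \<open>the successor in the second component separates bundles from single sets\<close>
  define key where "key A = (if card (W A) = 2 then (A - {x A}, Suc (x A div L)) else (A, 0))" for A
  define conf where "conf \<kappa> \<kappa>' \<longleftrightarrow> (\<exists>A\<in>\<A>. \<exists>A'\<in>\<A>. key A = \<kappa> \<and> key A' = \<kappa>' \<and> card (A \<inter> A') = 2)" for \<kappa> \<kappa>'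
  have fin\<A>: "finite \<A>" unfolding \<A>_def by (rule finite_subset[of _ "Pow {1..n}"]) auto
  have finA: "finite A" if "A \<in> \<A>" for A using that finite_subset unfolding \<A>_def by auto
  have WA: "W A \<subseteq> A" for A by (auto simp: W_def clashing_def)
  have x: "x A \<in> A - W A" if "A \<in> \<A>" "card (W A) = 2" for A
  proof -
    have "card A = 4" using that by (simp add: \<A>_def)
    then have "A - W A \<noteq> {}" using that(2) WA[of A] by auto
    then show ?thesis unfolding x_def using finA[OF that(1)] by (intro Max_in) auto
  qed
  have W_remove: "W (fst (key A)) = W A" if "A \<in> \<A>" for A
  proof (cases "card (W A) = 2")
    case True
    have "x A \<in> A" "x A \<notin> W A" using x[OF that True] by auto
    then have "f y \<noteq> f (x A)" if "y \<in> A" "y \<noteq> x A" for y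
      using that by (auto simp: W_def clashing_def)
    then have "W (A - {x A}) = W A" by (fastforce simp: W_def clashing_def)
    then show ?thesis using True by (simp add: key_def)
  next
    case False
    then show ?thesis by (simp add: key_def)
  qed
  have same_key: "card (A \<inter> B) \<noteq> 2" if AB: "A \<in> \<A>" "B \<in> \<A>" "key A = key B" for A B
  proof -
    have c4: "card A = 4" "card B = 4" using AB by (auto simp: \<A>_def)
    have "fst (key A) \<subseteq> A \<inter> B"
      using AB(3) by (auto simp: key_def split: if_splits)
    then have "card (fst (key A)) \<le> card (A \<inter> B)"
      using finA[OF AB(1)] by (intro card_mono) auto
    moreover have "card (fst (key A)) \<ge> 3"
      using c4 x[OF AB(1)] by (auto simp: key_def card_Diff_singleton_if)
    ultimately show ?thesis by linarith
  qed
  define d where "d = 18 * L * n * q + 6 * n * (n div L + 1)"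
  have degree: "card {\<kappa>' \<in> key ` \<A>. \<kappa>' \<noteq> \<kappa> \<and> conf \<kappa> \<kappa>'} \<le> d" if \<kappa>: "\<kappa> \<in> key ` \<A>" for \<kappa>
  proof -
    define T where "T = fst \<kappa>"
    define pairs where "pairs B = {s. s \<subseteq> B \<and> card s = 2}" for B :: "nat set"
    define X where "X = (\<Union>s\<in>pairs T. (\<lambda>(w, i). (insert w s, Suc i)) ` ({1..n} \<times> {..n div L}))"
    define cls where "cls = {A \<in> \<A>. key A = \<kappa>}"
    define off where "off s = {A \<in> \<A>. s \<subseteq> A \<and> W A \<noteq> s}" for s
    define Y where "Y = (\<Union>A\<in>cls. \<Union>s\<in>pairs A. key ` off s)"
    obtain A0 where A0: "A0 \<in> \<A>" "\<kappa> = key A0" using \<kappa> by blast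
    have T: "finite T" "card T \<le> 4"
      using finA[OF A0(1)] A0 by (auto simp: T_def key_def \<A>_def card_Diff_singleton_if)
    have pairs: "finite (pairs B)" "card (pairs B) \<le> 6" if "finite B" "card B \<le> 4" for B
    proof -
      show "finite (pairs B)" using that by (simp add: pairs_def)
      have "card (pairs B) = card B choose 2" using that by (simp add: pairs_def n_subsets)
      also have "\<dots> \<le> 4 choose 2" using that(2) by (rule binomial_right_mono)
      finally show "card (pairs B) \<le> 6" by (simp add: choose_two)
    qed
    have "card X \<le> (\<Sum>s\<in>pairs T. card ((\<lambda>(w, i). (insert w s, Suc i)) ` ({1..n} \<times> {..n div L})))"
      unfolding X_def using pairs(1)[OF T] by (rule card_UN_le)
    also have "\<dots> \<le> (\<Sum>s\<in>pairs T. n * (n div L + 1))"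
    proof (rule sum_mono)
      fix s
      have "card ((\<lambda>(w, i). (insert w s, Suc i)) ` ({1..n} \<times> {..n div L})) \<le> card ({1..n} \<times> {..n div L})"
        by (rule card_image_le) simp
      then show "card ((\<lambda>(w, i). (insert w s, Suc i)) ` ({1..n} \<times> {..n div L})) \<le> n * (n div L + 1)"
        by (simp add: card_cartesian_product)
    qed
    also have "\<dots> \<le> 6 * (n * (n div L + 1))"
      unfolding sum_constant using pairs(2)[OF T] by (intro mult_le_mono) simp_all
    finally have cX: "card X \<le> 6 * n * (n div L + 1)" by simp
    have off: "card (off s) \<le> 3 * n * q" if "card s = 2" for s
      using card_clash_off_pair[of "{1..n}" n f q s] fib that
      unfolding off_def \<A>_def W_def by (simp add: conj_ac)
    have fincls: "finite cls" using fin\<A> by (simp add: cls_def)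
    have "card cls \<le> L"
    proof (cases "snd \<kappa>")
      case 0
      then have "cls \<subseteq> {T}" by (auto simp: cls_def key_def T_def split: if_splits)
      then have "card cls \<le> card {T}" by (rule card_mono[rotated]) simp
      then show ?thesis using L by simp
    next
      case (Suc i)
      have "cls \<subseteq> (\<lambda>y. insert y T) ` {i * L..<i * L + L}"
      proof
        fix A assume "A \<in> cls"
        then have A: "A \<in> \<A>" "key A = \<kappa>" by (auto simp: cls_def)
        then have c: "card (W A) = 2" using Suc by (auto simp: key_def split: if_splits)
        then have "T = A - {x A}" "i = x A div L" using A Suc by (auto simp: key_def T_def)
        moreover from this have "x A \<in> {i * L..<i * L + L}"
          using L dividend_less_div_times[of L "x A"] by (simp add: add.commute)
        ultimately show "A \<in> (\<lambda>y. insert y T) ` {i * L..<i * L + L}"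
          using x[OF A(1) c] by (intro image_eqI[of _ _ "x A"]) auto
      qed
      then have "card cls \<le> card {i * L..<i * L + L}" by (rule surj_card_le[rotated]) simp
      then show ?thesis by simp
    qed
    have "card Y \<le> (\<Sum>A\<in>cls. card (\<Union>s\<in>pairs A. key ` off s))"
      unfolding Y_def using fincls by (rule card_UN_le)
    also have "\<dots> \<le> (\<Sum>A\<in>cls. 6 * (3 * n * q))"
    proof (rule sum_mono)
      fix A assume "A \<in> cls"
      then have "A \<in> \<A>" by (simp add: cls_def)
      then have A: "finite A" "card A \<le> 4" using finA[of A] by (simp_all add: \<A>_def)
      have "card (\<Union>s\<in>pairs A. key ` off s) \<le> (\<Sum>s\<in>pairs A. card (key ` off s))"
        using pairs(1)[OF A] by (rule card_UN_le)
      also have "\<dots> \<le> (\<Sum>s\<in>pairs A. 3 * n * q)"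
      proof (rule sum_mono)
        fix s assume "s \<in> pairs A"
        then have "card (off s) \<le> 3 * n * q" using off by (simp add: pairs_def)
        moreover have "card (key ` off s) \<le> card (off s)"
          by (rule card_image_le) (simp add: off_def fin\<A>)
        ultimately show "card (key ` off s) \<le> 3 * n * q" by linarith
      qed
      also have "\<dots> \<le> 6 * (3 * n * q)"
        unfolding sum_constant using pairs(2)[OF A] by (intro mult_le_mono) simp_all
      finally show "card (\<Union>s\<in>pairs A. key ` off s) \<le> 6 * (3 * n * q)" .
    qed
    also have "\<dots> \<le> L * (6 * (3 * n * q))"
      unfolding sum_constant using \<open>card cls \<le> L\<close> by (intro mult_le_mono) simp_all
    also have "\<dots> = 18 * L * n * q" by simp
    finally have cY: "card Y \<le> 18 * L * n * q" .
    have "{\<kappa>' \<in> key ` \<A>. \<kappa>' \<noteq> \<kappa> \<and> conf \<kappa> \<kappa>'} \<subseteq> Y \<union> X"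
    proof
      fix \<kappa>' assume "\<kappa>' \<in> {\<kappa>' \<in> key ` \<A>. \<kappa>' \<noteq> \<kappa> \<and> conf \<kappa> \<kappa>'}"
      then obtain A A' where A: "A \<in> \<A>" "A' \<in> \<A>" "key A = \<kappa>" "key A' = \<kappa>'" "card (A \<inter> A') = 2"
        by (auto simp: conf_def)
      define s where "s = A \<inter> A'"
      show "\<kappa>' \<in> Y \<union> X"
      \<comment> \<open>\<open>X\<close> contains the bundles whose clashing points are exactly \<open>s\<close>, and \<open>Y\<close> the other ones\<close>
      proof (cases "W A' = s")
        case False
        then have "A' \<in> off s" using A by (auto simp: off_def s_def)
        moreover have "s \<in> pairs A" using A by (auto simp: pairs_def s_def)
        moreover have "A \<in> cls" using A by (simp add: cls_def)
        ultimately show ?thesis using A(4) unfolding Y_def by blast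
      next
        case True
        have c2: "card (W A') = 2" using True A by (simp add: s_def)
        have "s \<subseteq> W A"
        proof
          fix u assume u: "u \<in> s"
          then obtain y where y: "y \<in> A'" "y \<noteq> u" "f y = f u"
            using True by (auto simp: W_def clashing_def)
          then have "y \<in> W A'" using u by (auto simp: W_def clashing_def s_def)
          then have "y \<in> A" using True by (auto simp: s_def)
          then show "u \<in> W A" using u y by (auto simp: W_def clashing_def s_def)
        qed
        also have "W A = W T" using W_remove[OF A(1)] A(3) by (simp add: T_def)
        also have "W T \<subseteq> T" by (rule WA)
        finally have sT: "s \<in> pairs T" using A by (simp add: pairs_def s_def)
        have xA': "x A' \<in> A' - s" using x[OF A(2) c2] True by simp
        have "card A' = 4" "A' \<subseteq> {1..n}" using A by (auto simp: \<A>_def)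
        have "s \<subseteq> A'" "card s = 2" using A(5) by (auto simp: s_def)
        then obtain w where w: "A' - s = {x A', w}" "x A' \<noteq> w"
          using card_4_remove_2[OF \<open>card A' = 4\<close>, of s "x A'"] xA' by blast
        have "A' = s \<union> {x A', w}" using w(1) \<open>s \<subseteq> A'\<close> by blast
        then have "A' - {x A'} = insert w s" using w(2) xA' by auto
        then have "\<kappa>' = (insert w s, Suc (x A' div L))"
          using c2 A(4) by (simp add: key_def)
        moreover have "w \<in> {1..n}" "x A' \<le> n" using w \<open>A' \<subseteq> {1..n}\<close> by auto
        ultimately show ?thesis using sT unfolding X_def
          by (intro UnI2 UN_I[OF sT] image_eqI[of _ _ "(w, x A' div L)"]) (auto intro: div_le_mono)
      qed
    qed
    moreover have "finite X" unfolding X_def using pairs(1)[OF T] by auto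
    moreover have "finite Y"
      unfolding Y_def
    proof (intro finite_UN_I fincls finite_imageI)
      fix A s assume "A \<in> cls"
      then have "A \<in> \<A>" by (simp add: cls_def)
      then show "finite (pairs A)" using finA[of A] by (simp add: pairs_def)
      show "finite (off s)" using fin\<A> by (simp add: off_def)
    qed
    ultimately have "card {\<kappa>' \<in> key ` \<A>. \<kappa>' \<noteq> \<kappa> \<and> conf \<kappa> \<kappa>'} \<le> card (Y \<union> X)"
      by (intro card_mono) auto
    also have "\<dots> \<le> card Y + card X" by (rule card_Un_le)
    finally show ?thesis using cX cY unfolding d_def by linarith
  qed
  have sym: "conf \<kappa>' \<kappa>" if "conf \<kappa> \<kappa>'" for \<kappa> \<kappa>' using that unfolding conf_def by (metis Int_commute)
  obtain c :: "nat set \<times> nat \<Rightarrow> nat" where c: "\<forall>\<kappa>\<in>key ` \<A>. c \<kappa> \<le> d"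
    "\<forall>\<kappa>\<in>key ` \<A>. \<forall>\<kappa>'\<in>key ` \<A>. \<kappa> \<noteq> \<kappa>' \<and> conf \<kappa> \<kappa>' \<longrightarrow> c \<kappa> \<noteq> c \<kappa>'"
    using greedy_colouring[of "key ` \<A>" conf d] fin\<A> sym degree by blast
  have "c (key A) \<noteq> c (key B)" if "A \<in> \<A>" "B \<in> \<A>" "card (A \<inter> B) = 2" for A B
  proof -
    have "key A \<noteq> key B" using same_key that by blast
    moreover have "conf (key A) (key B)" using that unfolding conf_def by blast
    ultimately show ?thesis using c(2) that by blast
  qed
  then show ?thesis
    using c(1) unfolding d_def \<A>_def by (intro exI[of _ "c \<circ> key"]) auto
qed

section \<open>Colouring the transversal sets by leading coefficients\<close>

text \<open>Newton interpolation works over the integers modulo \<open>q\<close> because the differences of the nodes are units.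
Bounding the coefficients rather than the degree covers the empty case.\<close>

lemma interpolation_mod:
  fixes q :: int and x :: "nat \<Rightarrow> int"
  assumes "finite J" and cop: "\<And>i j. i \<in> J \<Longrightarrow> j \<in> J \<Longrightarrow> i \<noteq> j \<Longrightarrow> coprime (int i - int j) q"
  shows "\<exists>p. (\<forall>k\<ge>card J. coeff p k = 0) \<and> (\<forall>j\<in>J. [poly p (int j) = x j] (mod q))"
  using assms
proof (induction J rule: finite_induct)
  case empty
  show ?case by (intro exI[of _ 0]) simp
next
  case (insert j J)
  then obtain p where p: "\<And>k. k \<ge> card J \<Longrightarrow> coeff p k = 0"
    "\<And>i. i \<in> J \<Longrightarrow> [poly p (int i) = x i] (mod q)" by (metis insert_iff)
  define N where "N = (\<Prod>i\<in>J. [:- int i, 1:])"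
  have "degree N = (\<Sum>i\<in>J. degree [:- int i, 1:])"
    unfolding N_def by (rule degree_prod_eq_sum_degree) simp
  then have degN: "degree N = card J" by simp
  have polyN: "poly N y = (\<Prod>i\<in>J. y - int i)" for y unfolding N_def poly_prod by simp
  have "coprime (poly N (int j)) q"
    unfolding polyN by (rule prod_coprime_left) (use insert in auto)
  then obtain u where u: "[poly N (int j) * u = 1] (mod q)"
    using cong_solve_coprime_int by blast
  define p' where "p' = p + smult (u * (x j - poly p (int j))) N"
  have "\<forall>k\<ge>card (insert j J). coeff p' k = 0"
    using p(1) insert.hyps degN by (auto simp: p'_def coeff_eq_0)
  moreover have "[poly p' (int i) = x i] (mod q)" if "i \<in> insert j J" for i
  proof (cases "i = j")
    case True
    have "[poly p (int j) + (poly N (int j) * u) * (x j - poly p (int j)) =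
      poly p (int j) + 1 * (x j - poly p (int j))] (mod q)"
      using u by (intro cong_add cong_mult cong_refl)
    then show ?thesis using True by (simp add: p'_def algebra_simps)
  next
    case False
    then have "i \<in> J" using that by simp
    moreover from this have "poly N (int i) = 0" unfolding polyN using insert.hyps by auto
    ultimately show ?thesis using p(2) by (simp add: p'_def)
  qed
  ultimately show ?case by blast
qed

text \<open>Modulo \<open>q\<close> the difference is linear, and a linear polynomial with two roots whose difference is a
unit vanishes.\<close>

lemma cubics_agreeing_twice:
  fixes p p' :: "int poly" and q :: int
  assumes deg: "\<forall>k\<ge>4. coeff p k = 0" "\<forall>k\<ge>4. coeff p' k = 0"
    and lead: "[coeff p 2 = coeff p' 2] (mod q)" "[coeff p 3 = coeff p' 3] (mod q)"
    and ij: "[poly p i = poly p' i] (mod q)" "[poly p j = poly p' j] (mod q)" "coprime (i - j) q"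
  shows "[poly p t = poly p' t] (mod q)"
proof -
  define d where "d = p - p'"
  have d4: "coeff d k = 0" if "k \<ge> 4" for k using deg that by (simp add: d_def)
  have d23: "q dvd coeff d 2" "q dvd coeff d 3" using lead by (simp_all add: d_def cong_iff_dvd_diff)
  have "degree d \<le> 3" by (rule degree_le) (use d4 in auto)
  have poly_d: "poly d y = coeff d 0 + coeff d 1 * y + coeff d 2 * y ^ 2 + coeff d 3 * y ^ 3" for y
  proof -
    have "poly d y = (\<Sum>k\<le>degree d. coeff d k * y ^ k)" by (rule poly_altdef)
    also have "\<dots> = (\<Sum>k\<le>3. coeff d k * y ^ k)"
      using \<open>degree d \<le> 3\<close> by (intro sum.mono_neutral_left) (auto simp: coeff_eq_0)
    finally show ?thesis by (simp add: numeral_eq_Suc)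
  qed
  have lin: "q dvd poly d y \<longleftrightarrow> q dvd coeff d 0 + coeff d 1 * y" for y
  proof -
    have "q dvd coeff d 2 * y ^ 2 + coeff d 3 * y ^ 3" using d23 by (intro dvd_add dvd_mult2)
    then show ?thesis unfolding poly_d by (metis add.assoc dvd_add_left_iff)
  qed
  have "q dvd poly d i" "q dvd poly d j" using ij by (simp_all add: d_def cong_iff_dvd_diff)
  then have ij': "q dvd coeff d 0 + coeff d 1 * i" "q dvd coeff d 0 + coeff d 1 * j"
    by (simp_all only: lin)
  then have "q dvd (coeff d 0 + coeff d 1 * i) - (coeff d 0 + coeff d 1 * j)" by (rule dvd_diff)
  then have "q dvd coeff d 1 * (i - j)" by (simp add: algebra_simps)
  then have d1: "q dvd coeff d 1"
    using ij(3) by (metis coprime_commute coprime_dvd_mult_left_iff)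
  then have "q dvd coeff d 0" using ij'(1) by (metis dvd_add_left_iff dvd_mult2)
  then have "q dvd poly d t" unfolding lin using d1 by simp
  then show ?thesis by (simp add: d_def cong_iff_dvd_diff)
qed

text \<open>The colour of \<open>A\<close> is the colour that \<open>ex_block_colouring\<close> gives to the parts of \<open>A\<close> and the two leading
coefficients \<open>z A\<close> of an interpolating cubic. If \<open>A\<close> and \<open>B\<close> have the same colour and meet in two points,
they share two parts, so their parts lie in one 5-set \<open>I\<close> and \<open>z A = z B\<close>. Then the cubics agree, and
\<open>A\<close> and \<open>B\<close> have a common point over each of the at least \<open>4 + 4 - 5 = 3\<close> parts that they share.\<close>

lemma colour_transversal_sets:
  fixes m q n :: nat and P F :: "nat set set"
  assumes m: "m \<ge> 5" and q: "coprime q (fact m)" and n: "n < m * q"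
    and P: "\<And>B. B \<in> P \<Longrightarrow> B \<subseteq> {..<m} \<and> card B = 5" "P \<noteq> {}"
    and lin: "\<And>B B' x y. B \<in> P \<Longrightarrow> B' \<in> P \<Longrightarrow> x \<in> B \<inter> B' \<Longrightarrow> y \<in> B \<inter> B' \<Longrightarrow> x \<noteq> y \<Longrightarrow> B = B'"
    and F: "\<And>I. I \<in> F \<Longrightarrow> I \<subseteq> {..<m} \<and> card I = 5"
    and cover: "\<And>J. J \<subseteq> {..<m} \<Longrightarrow> card J = 4 \<Longrightarrow> \<exists>I\<in>F. J \<subseteq> I"
  shows "\<exists>(K::nat) c. real K \<le> (real q ^ 2 + fact m) * (card F / card P) + fact m \<and>
    (\<forall>A. A \<subseteq> {1..n} \<and> card A = 4 \<and> inj_on (\<lambda>v. v mod m) A \<longrightarrow> c A < K) \<and>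
    (\<forall>A B. A \<subseteq> {1..n} \<and> card A = 4 \<and> inj_on (\<lambda>v. v mod m) A \<and>
       B \<subseteq> {1..n} \<and> card B = 4 \<and> inj_on (\<lambda>v. v mod m) B \<and> card (A \<inter> B) = 2 \<longrightarrow> c A \<noteq> c B)"
proof -
  define f where "f v = v mod m" for v
  define Z where "Z = {0..<int q} \<times> {0..<int q}"
  have cardZ: "finite Z" "card Z = q ^ 2"
    by (simp_all add: Z_def card_cartesian_product power2_eq_square)
  have "q > 0" using n by (cases q) auto
  have unit: "coprime (int i - int j) (int q)" if "i < m" "j < m" "i \<noteq> j" for i j
  proof -
    have "nat \<bar>int i - int j\<bar> dvd fact m" by (rule dvd_fact) (use that in auto)
    then have "coprime q (nat \<bar>int i - int j\<bar>)" using q coprime_divisors by (metis dvd_refl)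
    then have "coprime (int q) \<bar>int i - int j\<bar>" by (metis abs_ge_zero coprime_int_iff nat_0_le)
    then show ?thesis by (simp add: coprime_commute)
  qed
  obtain K ext col where
    K: "real K \<le> (card Z + fact (card {..<m})) * (card F / card P) + fact (card {..<m})" and
    ext: "\<And>J z. J \<subseteq> {..<m} \<Longrightarrow> card J = 4 \<Longrightarrow> z \<in> Z \<Longrightarrow>
       J \<subseteq> ext J z \<and> card (ext J z) = 5 \<and> col J z < K" and
    col: "\<And>J z J' z' x y. \<lbrakk>J \<subseteq> {..<m}; card J = 4; z \<in> Z; J' \<subseteq> {..<m}; card J' = 4; z' \<in> Z;
       col J z = col J' z'; x \<in> J \<inter> J'; y \<in> J \<inter> J'; x \<noteq> y\<rbrakk> \<Longrightarrow> ext J z = ext J' z' \<and> z = z'"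
  proof -
    show ?thesis
      by (rule ex_block_colouring[of "{..<m}" 5 P F 4 Z])
        (simp, simp add: m, fact P(1), fact P(2), fact lin, fact F, fact cover, fact cardZ(1), fact that)
  qed
  define TT where "TT A \<longleftrightarrow> A \<subseteq> {1..n} \<and> card A = 4 \<and> inj_on f A" for A
  have J: "f ` A \<subseteq> {..<m}" "card (f ` A) = 4" "finite A" if "TT A" for A
  proof -
    show "f ` A \<subseteq> {..<m}" using m by (auto simp: f_def)
    show "card (f ` A) = 4" using that by (simp add: TT_def card_image)
    show "finite A" using that by (auto simp: TT_def intro: finite_subset)
  qed
  have "\<exists>p. (\<forall>k\<ge>4. coeff p k = 0) \<and> (\<forall>v\<in>A. [poly p (int (f v)) = int (v div m)] (mod int q))"
    if A: "TT A" for A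
  proof -
    have inj: "inj_on f A" using A by (simp add: TT_def)
    have "\<exists>p. (\<forall>k\<ge>card (f ` A). coeff p k = 0) \<and>
        (\<forall>j\<in>f ` A. [poly p (int j) = int (inv_into A f j div m)] (mod int q))"
    proof (rule interpolation_mod)
      show "coprime (int i - int j) (int q)" if "i \<in> f ` A" "j \<in> f ` A" "i \<noteq> j" for i j
        using J(1)[OF A] that by (intro unit) auto
    qed (use J(3)[OF A] in simp)
    then show ?thesis using J(2)[OF A] inj by auto
  qed
  then obtain p where p: "\<And>A. TT A \<Longrightarrow> \<forall>k\<ge>4. coeff (p A) k = 0"
    "\<And>A v. TT A \<Longrightarrow> v \<in> A \<Longrightarrow> [poly (p A) (int (f v)) = int (v div m)] (mod int q)" by metis
  define z where "z A = (coeff (p A) 2 mod int q, coeff (p A) 3 mod int q)" for A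
  have zZ: "z A \<in> Z" for A using \<open>q > 0\<close> by (simp add: z_def Z_def)
  define c where "c A = col (f ` A) (z A)" for A
  have "c A < K" if "TT A" for A using ext[OF J(1,2)[OF that] zZ] by (simp add: c_def)
  moreover have "c A \<noteq> c B" if A: "TT A" and B: "TT B" and AB: "card (A \<inter> B) = 2" for A B
  proof
    assume eq: "c A = c B"
    obtain v w where vw: "A \<inter> B = {v, w}" "v \<noteq> w" using AB by (auto simp: card_2_iff)
    then have vw': "v \<in> A" "v \<in> B" "w \<in> A" "w \<in> B" by blast+
    then have fvw: "f v \<noteq> f w" using A vw(2) by (auto simp: TT_def dest: inj_onD)
    have same: "ext (f ` A) (z A) = ext (f ` B) (z B)" "z A = z B"
    proof -
      have "col (f ` A) (z A) = col (f ` B) (z B)" using eq by (simp only: c_def)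
      moreover have "f v \<in> f ` A \<inter> f ` B" "f w \<in> f ` A \<inter> f ` B" using vw' by simp_all
      ultimately have "ext (f ` A) (z A) = ext (f ` B) (z B) \<and> z A = z B"
        using col[OF J(1,2)[OF A] zZ J(1,2)[OF B] zZ _ _ _ fvw] by blast
      then show "ext (f ` A) (z A) = ext (f ` B) (z B)" "z A = z B" by blast+
    qed
    have agree: "[poly (p A) t = poly (p B) t] (mod int q)" for t
    proof (rule cubics_agreeing_twice[OF p(1)[OF A] p(1)[OF B]])
      show "[coeff (p A) 2 = coeff (p B) 2] (mod int q)" "[coeff (p A) 3 = coeff (p B) 3] (mod int q)"
        using same(2) by (simp_all add: z_def unique_euclidean_semiring_class.cong_def)
      show "[poly (p A) (int (f v)) = poly (p B) (int (f v))] (mod int q)"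
        "[poly (p A) (int (f w)) = poly (p B) (int (f w))] (mod int q)"
        using cong_trans[OF p(2)[OF A] cong_sym[OF p(2)[OF B]]] vw' by blast+
      show "coprime (int (f v) - int (f w)) (int q)"
        by (rule unit) (use m fvw in \<open>auto simp: f_def\<close>)
    qed
    have sub: "f ` A \<inter> f ` B \<subseteq> f ` (A \<inter> B)"
    proof
      fix i assume "i \<in> f ` A \<inter> f ` B"
      then obtain a b where "a \<in> A" "b \<in> B" "i = f a" "i = f b" by blast
      then have ab: "a \<in> A" "b \<in> B" "f a = i" "f b = i" by simp_all
      have "[int (a div m) = int (b div m)] (mod int q)"
      proof -
        have "[int (a div m) = poly (p A) (int i)] (mod int q)"
          using p(2)[OF A ab(1)] unfolding ab(3) by (rule cong_sym)
        also have "[poly (p A) (int i) = poly (p B) (int i)] (mod int q)" by (rule agree)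
        also have "[poly (p B) (int i) = int (b div m)] (mod int q)"
          using p(2)[OF B ab(2)] unfolding ab(4) .
        finally show ?thesis .
      qed
      moreover have "a \<le> n" "b \<le> n" using A B ab by (auto simp: TT_def)
      then have "a < q * m" "b < q * m" using n by (simp_all add: mult.commute)
      then have "a div m < q" "b div m < q" by (simp_all only: less_mult_imp_div_less)
      ultimately have "a div m = b div m" by (simp add: unique_euclidean_semiring_class.cong_def)
      then have "a = b" using ab(3,4) unfolding f_def by (metis div_mult_mod_eq)
      then show "i \<in> f ` (A \<inter> B)" using ab by blast
    qed
    define I where "I = ext (f ` A) (z A)"
    have I: "f ` A \<union> f ` B \<subseteq> I" "card I = 5"
      using ext[OF J(1,2)[OF A] zZ, of A] ext[OF J(1,2)[OF B] zZ, of B] same(1) by (auto simp: I_def)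
    then have "card (f ` A \<union> f ` B) \<le> 5"
      by (metis card_mono card.infinite zero_neq_numeral)
    moreover have "card (f ` A) + card (f ` B) = card (f ` A \<union> f ` B) + card (f ` A \<inter> f ` B)"
      by (rule card_Un_Int) (use J A B in auto)
    ultimately have "card (f ` A \<inter> f ` B) \<ge> 3" using J(2)[OF A] J(2)[OF B] by linarith
    also have "card (f ` A \<inter> f ` B) \<le> card (f ` (A \<inter> B))"
      using sub J(3)[OF A] by (intro card_mono) auto
    also have "\<dots> \<le> card (A \<inter> B)" using J(3)[OF A] by (intro card_image_le) auto
    finally show False using AB by simp
  qed
  ultimately show ?thesis
    using K cardZ unfolding TT_def f_def by (intro exI[of _ K] exI[of _ c]) auto
qed

section \<open>The chromatic number\<close>

lemma chromatic_number_le: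
  assumes "\<And>A. A \<subseteq> {1..n} \<Longrightarrow> card A = k \<Longrightarrow> c A < K"
    and "\<And>A B. A \<subseteq> {1..n} \<Longrightarrow> card A = k \<Longrightarrow> B \<subseteq> {1..n} \<Longrightarrow> card B = k \<Longrightarrow> card (A \<inter> B) = t \<Longrightarrow> A \<noteq> B \<Longrightarrow> c A \<noteq> c B"
  shows "chromatic_number (intersection_graph n k t) \<le> K"
proof -
  have "proper_colouring (intersection_graph n k t) K c"
    unfolding proper_colouring_def
  proof (intro conjI ballI allI impI)
    fix A assume "A \<in> verts (intersection_graph n k t)"
    then show "c A < K" using assms(1) by (simp add: intersection_graph_def)
  next
    fix A B assume "A \<rightarrow>\<^bsub>intersection_graph n k t\<^esub> B"
    then show "c A \<noteq> c B"
      using assms(2) by (auto simp: intersection_graph_def arcs_ends_def arc_to_ends_def)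
  qed
  then show ?thesis unfolding chromatic_number_def by (blast intro: Least_le)
qed

text \<open>The parameters are \<open>L = 5\<^sup>k\<close> and \<open>m = L\<^sup>2 = 5 ^ (2 k)\<close>, and \<open>q\<close> is congruent to 1 modulo \<open>m!\<close>, hence coprime to
it, with \<open>n < m q \<le> n + D\<close>. Such \<open>q\<close> occur in every interval of length \<open>m!\<close>, so \<open>D\<close> does not depend on \<open>n\<close>. The transversal sets cost \<open>(n + D)\<^sup>2 (1/6 + 40/m)\<close> and the other sets
\<open>(n + D)\<^sup>2 (18 + 6)/L + 6 n\<close> colours, up to constants.\<close>

lemma chromatic_number_bound:
  fixes k :: nat
  assumes k: "k \<ge> 1"
  shows "\<exists>D E. \<forall>n. real (chromatic_number (intersection_graph n 4 2)) \<le>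
    (real n + D) ^ 2 * (1 / 6 + 64 / 5 ^ k) + 6 * real n + E"
proof -
  define L :: nat where "L = 5 ^ k"
  define m where "m = L ^ 2"
  have L5: "L \<ge> 5" using k unfolding L_def by (metis one_le_numeral power_increasing power_one_right)
  have mL: "m = L * L" by (simp add: m_def power2_eq_square)
  have "5 * 5 \<le> L * L" using L5 by (intro mult_le_mono)
  then have m5: "m \<ge> 25" by (simp add: mL)
  have "m = 5 ^ (2 * k)" by (simp add: m_def L_def power_mult mult.commute[of 2 k])
  then obtain P where P: "linear_5_packing m P" "20 * card P + m = m ^ 2"
    using ex_steiner_system_5[of "2 * k"] by auto
  have "m \<ge> 5" using m5 by simp
  then obtain F where F': "\<forall>I\<in>F. I \<subseteq> {..<m} \<and> card I = 5"
    "\<forall>J. J \<subseteq> {..<m} \<and> card J = 4 \<longrightarrow> (\<exists>I\<in>F. J \<subseteq> I)"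
    "5 * card F \<le> (m choose 4) + 5 * m ^ 3"
    using ex_covering_5_of_4[of m] by blast
  have F: "I \<subseteq> {..<m} \<and> card I = 5" if "I \<in> F" for I using F'(1) that by blast
  have cover: "\<exists>I\<in>F. J \<subseteq> I" if "J \<subseteq> {..<m}" "card J = 4" for J using F'(2) that by blast
  define g :: nat where "g = fact m"
  have g: "g > 0" by (simp add: g_def)
  define \<rho> where "\<rho> = real (card F) / real (card P)"
  define D where "D = real (m * g + m)"
  have P_ne: "P \<noteq> {}"
  proof
    assume "P = {}"
    then have "m = m * m" using P(2) by (simp add: power2_eq_square)
    then show False using m5 by simp
  qed
  \<comment> \<open>the ratio of the design sizes \<open>m\<^sup>4/120 + m\<^sup>3\<close> and \<open>m(m-1)/20\<close>\<close>
  have rho: "\<rho> \<le> real m ^ 2 / 6 + 40 * real m"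
  proof -
    have cP: "20 * real (card P) = real m ^ 2 - real m"
      using P(2) by (metis add_diff_cancel_right' of_nat_add of_nat_mult of_nat_numeral of_nat_power)
    have "(m choose 4) * fact 4 \<le> m ^ 4" by (rule binomial_fact_pow)
    then have "24 * (m choose 4) \<le> m ^ 4" by (simp add: fact_numeral)
    then have "120 * card F \<le> m ^ 4 + 120 * m ^ 3" using F'(3) by linarith
    then have "real (120 * card F) \<le> real (m ^ 4 + 120 * m ^ 3)" by (simp only: of_nat_le_iff)
    then have cF: "120 * real (card F) \<le> real m ^ 4 + 120 * real m ^ 3" by simp
    have rm: "real m \<ge> 25" using m5 by simp
    have "240 * real m ^ 2 \<le> 10 * real m * real m ^ 2" using rm by (intro mult_right_mono) auto
    then have "120 * real m ^ 3 + 240 * real m ^ 2 \<le> 239 * real m ^ 3"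
      by (simp add: power3_eq_cube power2_eq_square) (use rm in \<open>smt (verit) mult_nonneg_nonneg\<close>)
    then have "120 * real (card F) \<le> (real m ^ 2 + 240 * real m) * (real m ^ 2 - real m)"
      using cF by (simp add: algebra_simps power2_eq_square power3_eq_cube power4_eq_xxxx)
    also have "\<dots> = 120 * ((real m ^ 2 / 6 + 40 * real m) * card P)"
      unfolding cP[symmetric] by (simp add: algebra_simps)
    finally have "real (card F) \<le> (real m ^ 2 / 6 + 40 * real m) * card P" by simp
    moreover have "card P > 0" using cP rm by (cases "card P = 0") (auto simp: power2_eq_square)
    ultimately show ?thesis unfolding \<rho>_def by (simp add: pos_divide_le_eq)
  qed
  have rho0: "\<rho> \<ge> 0" by (simp add: \<rho>_def)
  define E where "E = real g * \<rho> + real g + 1"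
  have "real (chromatic_number (intersection_graph n 4 2)) \<le>
    (real n + D) ^ 2 * (1 / 6 + 64 / 5 ^ k) + 6 * real n + E" for n
  proof -
    define l where "l = n div (m * g) + 1"
    define q where "q = g * l + 1"
    define f where "f v = v mod m" for v :: nat
    have mg: "m * g > 0" using m5 g by simp
    have ml: "m * q = m * g * (n div (m * g)) + m * g + m" by (simp add: q_def l_def algebra_simps)
    have "m * g * (n div (m * g)) \<le> n" by simp
    then have "real (m * q) \<le> real (n + (m * g + m))" unfolding ml by (subst of_nat_le_iff) linarith
    then have qD: "real m * real q \<le> real n + D" by (simp add: D_def)
    have "n < m * g * (n div (m * g)) + m * g"
      using dividend_less_times_div[OF mg, of n] by simp
    then have nq: "n < m * q" unfolding ml by linarith
    have cop: "coprime q (fact m)"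
      using coprime_Suc_left_nat[of "g * l"] unfolding q_def g_def[symmetric] by simp
    have f_eq: "(\<lambda>v. v mod m) = f" by (simp add: f_def fun_eq_iff)
    have "\<exists>(K::nat) c. real K \<le> (real q ^ 2 + fact m) * (card F / card P) + fact m \<and>
      (\<forall>A. A \<subseteq> {1..n} \<and> card A = 4 \<and> inj_on f A \<longrightarrow> c A < K) \<and>
      (\<forall>A B. A \<subseteq> {1..n} \<and> card A = 4 \<and> inj_on f A \<and>
         B \<subseteq> {1..n} \<and> card B = 4 \<and> inj_on f B \<and> card (A \<inter> B) = 2 \<longrightarrow> c A \<noteq> c B)"
      unfolding f_eq[symmetric]
    proof (rule colour_transversal_sets)
      show "5 \<le> m" using m5 by simp
      show "B \<subseteq> {..<m} \<and> card B = 5" if "B \<in> P" for B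
        using P(1) that by (simp add: linear_5_packing_def)
      show "B = B'" if "B \<in> P" "B' \<in> P" "x \<in> B \<inter> B'" "y \<in> B \<inter> B'" "x \<noteq> y" for B B' x y
        using P(1) that unfolding linear_5_packing_def by blast
    qed (fact cop nq P_ne F cover)+
    then obtain K c1 where K: "real K \<le> (real q ^ 2 + fact m) * (card F / card P) + fact m"
      and c1: "\<forall>A. A \<subseteq> {1..n} \<and> card A = 4 \<and> inj_on f A \<longrightarrow> c1 A < K"
       "\<forall>A B. A \<subseteq> {1..n} \<and> card A = 4 \<and> inj_on f A \<and>
         B \<subseteq> {1..n} \<and> card B = 4 \<and> inj_on f B \<and> card (A \<inter> B) = 2 \<longrightarrow> c1 A \<noteq> c1 B"
      by (elim exE conjE)
    have fib: "card {u \<in> {1..n}. f u = f v} \<le> q" for v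
    proof -
      have "card {u \<in> {1..n}. f u = f v} \<le> card {..<q}"
      proof (rule card_inj_on_le[where f = "\<lambda>u. u div m"])
        show "inj_on (\<lambda>u. u div m) {u \<in> {1..n}. f u = f v}"
        proof (rule inj_onI)
          fix x y assume "x \<in> {u \<in> {1..n}. f u = f v}" "y \<in> {u \<in> {1..n}. f u = f v}" "x div m = y div m"
          then have "x div m = y div m" "x mod m = y mod m" by (auto simp: f_def)
          then show "x = y" by (metis div_mult_mod_eq)
        qed
        show "(\<lambda>u. u div m) ` {u \<in> {1..n}. f u = f v} \<subseteq> {..<q}"
        proof (rule image_subsetI)
          fix x assume "x \<in> {u \<in> {1..n}. f u = f v}"
          then have "x < q * m" using nq by (simp add: mult.commute)
          then have "x div m < q" using m5 by (simp add: div_less_iff_less_mult)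
          then show "x div m \<in> {..<q}" by simp
        qed
      qed simp
      then show ?thesis by simp
    qed
    define d where "d = 18 * L * n * q + 6 * n * (n div L + 1)"
    have "\<exists>c. (\<forall>A. A \<subseteq> {1..n} \<and> card A = 4 \<and> \<not> inj_on f A \<longrightarrow> c A \<le> d) \<and>
      (\<forall>A B. A \<subseteq> {1..n} \<and> card A = 4 \<and> \<not> inj_on f A \<and> B \<subseteq> {1..n} \<and> card B = 4 \<and>
         \<not> inj_on f B \<and> card (A \<inter> B) = 2 \<longrightarrow> c A \<noteq> c B)"
      unfolding d_def by (rule colour_clashing_sets) (use fib L5 in auto)
    then obtain c2 where c2: "\<forall>A. A \<subseteq> {1..n} \<and> card A = 4 \<and> \<not> inj_on f A \<longrightarrow> c2 A \<le> d"
      "\<forall>A B. A \<subseteq> {1..n} \<and> card A = 4 \<and> \<not> inj_on f A \<and> B \<subseteq> {1..n} \<and> card B = 4 \<and>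
         \<not> inj_on f B \<and> card (A \<inter> B) = 2 \<longrightarrow> c2 A \<noteq> c2 B"
      by (elim exE conjE)
    \<comment> \<open>disjoint palettes for the two kinds of 4-sets\<close>
    define c where "c A = (if inj_on f A then c1 A else K + c2 A)" for A
    have chi: "chromatic_number (intersection_graph n 4 2) \<le> K + (d + 1)"
    proof (rule chromatic_number_le)
      fix A assume A: "A \<subseteq> {1..n}" "card A = 4"
      show "c A < K + (d + 1)"
      proof -
        have "c1 A < K" if "inj_on f A" using c1(1) A that by blast
        moreover have "c2 A \<le> d" if "\<not> inj_on f A" using c2(1) A that by blast
        ultimately show ?thesis by (cases "inj_on f A") (simp_all add: c_def)
      qed
    next
      fix A B assume A: "A \<subseteq> {1..n}" "card A = 4" and B: "B \<subseteq> {1..n}" "card B = 4" and AB: "card (A \<inter> B) = 2"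
      show "c A \<noteq> c B"
      proof -
        have "c1 A < K" if "inj_on f A" using c1(1) A that by blast
        moreover have "c1 B < K" if "inj_on f B" using c1(1) B that by blast
        moreover have "c1 A \<noteq> c1 B" if "inj_on f A" "inj_on f B" using c1(2) A B AB that by blast
        moreover have "c2 A \<noteq> c2 B" if "\<not> inj_on f A" "\<not> inj_on f B" using c2(2) A B AB that by blast
        ultimately show ?thesis by (cases "inj_on f A"; cases "inj_on f B") (simp_all add: c_def)
      qed
    qed
    define X where "X = real n + D"
    have X0: "X \<ge> 0" "real n \<le> X" by (simp_all add: X_def D_def)
    have rL: "real L > 0" "real L \<ge> 1" "real m = real L * real L" using L5 by (simp_all add: mL)
    have rm: "real m > 0" using m5 by simp
    have qX: "real q \<le> X / real m" using qD rm unfolding X_def by (simp add: pos_le_divide_eq mult.commute)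
    have q2: "real q ^ 2 * \<rho> \<le> X ^ 2 * (1 / 6 + 40 / real L)"
    proof -
      have "real q ^ 2 * \<rho> \<le> (X / real m) ^ 2 * (real m ^ 2 / 6 + 40 * real m)"
        using rho rho0 qX by (intro mult_mono power_mono) auto
      also have "\<dots> = X ^ 2 * (1 / 6 + 40 / real m)"
        using rm by (simp add: field_simps power2_eq_square)
      also have "\<dots> \<le> X ^ 2 * (1 / 6 + 40 / real L)"
        using rL by (intro mult_left_mono add_left_mono divide_left_mono) auto
      finally show ?thesis .
    qed
    have d1: "18 * real L * real n * real q \<le> X ^ 2 * (18 / real L)"
    proof -
      have "18 * real L * real n * real q \<le> 18 * real L * X * (X / real m)"
        using X0 qX by (intro mult_mono) auto
      also have "\<dots> = X ^ 2 * (18 / real L)"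
        using rL(1) unfolding rL(3) by (simp add: field_simps power2_eq_square)
      finally show ?thesis .
    qed
    have d2: "6 * real n * (real (n div L) + 1) \<le> X ^ 2 * (6 / real L) + 6 * real n"
    proof -
      have "real (n div L) \<le> real n / real L" by (rule of_nat_div_le_of_nat)
      also have "\<dots> \<le> X / real L" using X0 by (intro divide_right_mono) auto
      finally have "6 * real n * (real (n div L)) \<le> 6 * X * (X / real L)"
        using X0 by (intro mult_mono) auto
      then show ?thesis by (simp add: algebra_simps power2_eq_square)
    qed
    have d_eq: "real d = 18 * real L * real n * real q + 6 * real n * (real (n div L) + 1)"
      by (simp add: d_def distrib_left)
    have "real K \<le> real q ^ 2 * \<rho> + (real g * \<rho> + real g)"
      using K unfolding \<rho>_def[symmetric] by (simp add: g_def algebra_simps)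
    moreover have "real (chromatic_number (intersection_graph n 4 2)) \<le> real K + real d + 1"
      using chi by linarith
    ultimately have "real (chromatic_number (intersection_graph n 4 2)) \<le>
      X ^ 2 * (1 / 6 + 40 / real L) + X ^ 2 * (18 / real L) + (X ^ 2 * (6 / real L) + 6 * real n) + E"
      using q2 d1 d2 d_eq unfolding E_def by linarith
    also have "\<dots> = X ^ 2 * (1 / 6 + 64 / real L) + 6 * real n + E"
      using rL(1) by (simp add: field_simps)
    finally show ?thesis unfolding X_def L_def by simp
  qed
  then show ?thesis by blast
qed

theorem theorem1p2:
  shows "\<exists>\<epsilon> :: nat \<Rightarrow> real. \<epsilon> \<longlonglongrightarrow> 0 \<and>
    (\<forall>\<^sub>F n in sequentially.
       real (chromatic_number (intersection_graph n 4 2)) \<le> (1 + \<epsilon> n) * (real n ^ 2 / 6))"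
proof -
  define \<chi> where "\<chi> n = real (chromatic_number (intersection_graph n 4 2))" for n
  \<comment> \<open>the excess over \<open>n\<^sup>2/6\<close>, cut off at 0 as the bound is only one-sided\<close>
  define \<epsilon> where "\<epsilon> n = max 0 (\<chi> n * 6 / real n ^ 2 - 1)" for n
  have "\<epsilon> \<longlonglongrightarrow> 0"
  proof (rule tendstoI)
    fix \<delta> :: real assume \<delta>: "\<delta> > 0"
    \<comment> \<open>\<open>384 = 6 \<cdot> 64\<close> is the relative error of \<open>chromatic_number_bound\<close>\<close>
    obtain k where k: "384 / \<delta> < 5 ^ k" using real_arch_pow[of 5 "384 / \<delta>"] by auto
    define a :: real where "a = 1 / 6 + 64 / 5 ^ Suc k"
    have "384 / 5 ^ Suc k < \<delta>"
    proof -
      have "(5::real) ^ k \<le> 5 ^ Suc k" by simp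
      then have "384 / \<delta> < 5 ^ Suc k" using k by linarith
      then show ?thesis using \<delta> by (simp add: field_simps)
    qed
    then have a: "6 * a - 1 < \<delta>" by (simp add: a_def field_simps)
    obtain D E where DE: "\<And>n. \<chi> n \<le> (real n + D) ^ 2 * a + 6 * real n + E"
      using chromatic_number_bound[of "Suc k"] unfolding a_def \<chi>_def by auto
    define b where "b n = ((real n + D) ^ 2 * a + 6 * real n + E) * 6 / real n ^ 2 - 1" for n
    have "a > 0" unfolding a_def by (simp add: add_pos_pos)
    then have "b \<longlonglongrightarrow> 6 * a - 1" unfolding b_def by real_asymp
    then have "\<forall>\<^sub>F n in sequentially. b n < \<delta>" using a by (rule order_tendstoD)
    then show "\<forall>\<^sub>F n in sequentially. dist (\<epsilon> n) 0 < \<delta>"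
    proof eventually_elim
      case (elim n)
      have "\<chi> n * 6 / real n ^ 2 - 1 \<le> b n"
        unfolding b_def using DE[of n] by (intro diff_right_mono divide_right_mono mult_right_mono) auto
      then show ?case using elim \<delta> by (simp add: \<epsilon>_def)
    qed
  qed
  moreover have "\<forall>\<^sub>F n in sequentially. \<chi> n \<le> (1 + \<epsilon> n) * (real n ^ 2 / 6)"
    using eventually_gt_at_top[of 0]
  proof eventually_elim
    case (elim n)
    have "\<chi> n * 6 / real n ^ 2 \<le> 1 + \<epsilon> n" unfolding \<epsilon>_def by linarith
    then show ?case using elim by (simp add: field_simps)
  qed
  ultimately show ?thesis unfolding \<chi>_def by blast
qed

end
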